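(* Let $\Lambda_{0,0}$ be a smooth $L$-isothermic surface, and let $\{\Lambda_{m,n}=f^+_{m,n}\oplus f^-_{m,n}\}_{m,n\ge0}$ be a lattice of Bianchi-Darboux transforms of $\Lambda_{0,0}$ (as defined in the context). Then for every $x\in\Sigma^2$ the discrete map $(m,n)\mapsto\Lambda_{m,n}(x)$ is a discrete $L$-isothermic surface; that is, discrete $L$-isothermic surfaces are obtained as Bianchi quadrilaterals of Bianchi-Darboux transformations.
   Context: Ambient space. $\mathbb{R}^{4,2}$ carries the metric $(\cdot,\cdot)$ of signature $(4,2)$ with light cone $\mathcal{L}$; $\mathbb{P}(\mathcal{L})$ is the Lie quadric and $Z$ is the set of lines in it (null $2$-planes of $\mathbb{R}^{4,2}$). $\Sigma^2$ is a simply connected surface; maps $f:\Sigma^2\to\mathbb{P}(\mathcal{L})$ are viewed as null line subbundles and maps $\Lambda:\Sigma^2\to Z$ as rank $2$ null subbundles of $\Sigma^2\times\mathbb{R}^{4,2}$. We identify $\wedge^2\mathbb{R}^{4,2}\cong\mathfrak{o}(4,2)$ via $(u\wedge v)w=(u,w)v-(v,w)u$. For non-orthogonal null lines $a,b$ and $s\in\mathbb{R}\setminus\{0\}$, $\Gamma_a^b(s)$ is the orthogonal map acting as $s$ on $b$, $s^{-1}$ on $a$, and the identity on $(a\oplus b)^\perp$. Isothermic maps. $f:\Sigma^2\to\mathbb{P}(\mathcal{L})$ is isothermic (an isothermic sphere congruence), with associated form $\eta$, if $\eta\in\Omega^1(f\wedge f^\perp)$ is closed and nowhere zero; its connections $\Gamma(t)=d+t\eta$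 are flat. A Darboux transform of $f$ with parameter $\mu\in\mathbb{R}\setminus\{0\}$ is a map $\hat f$, nowhere orthogonal to $f$, whose line bundle is $\Gamma(\mu)$-parallel; it is isothermic with connections $\hat\Gamma(t)=\Gamma_f^{\hat f}(1-\tfrac t\mu)\circ\Gamma(t)\circ\Gamma_f^{\hat f}(1-\tfrac t\mu)^{-1}$. If $f_j,f_\ell$ are Darboux transforms of $f_i$ with parameters $m_{ij}\ne m_{i\ell}$, Bianchi permutability gives $f_k=\Gamma_{f_i}^{f_j}(1-\tfrac{m_{i\ell}}{m_{ij}})f_\ell=\Gamma_{f_i}^{f_\ell}(1-\tfrac{m_{ij}}{m_{i\ell}})f_j$, simultaneously a Darboux transform of $f_j$ with parameter $m_{i\ell}$ and of $f_\ell$ with parameter $m_{ij}$. A constant conserved quantity of $f$ is a nonzero constant vector $c\in\mathbb{R}^{4,2}$ with $\Gamma(t)c=0$ for all $t$. $\Omega$-surfaces. Isothermic maps $f^+,f^-$ form an isotropic Darboux pair if there is a section $\tau$ of $f^+\wedge f^-$ with $\Gamma^-(t)=\exp(t\tau)\circ\Gamma^+(t)\circ\exp(-t\tau)$ for all $t$. An $\Omega$-surface is a Legendre immersion $\Lambda=f^+\oplus f^-:\Sigma^2\to Z$ spanned by an isotropic Darboux pair. If $\hat f^+$ is a Darboux transform of $f^+$ with parameter $\mu$, there is a unique $\hat f^-$, namely $\hat f^-=\exp(\mu\tau)\hat f^+$, that is a Darboux transform of $f^-$ with parameter $\mu$ and forms an isotropic Darboux pair with $\hat f^+$; $\hat\Lambda=\hat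 f^+\oplus\hat f^-$ is a Lie-Darboux transform of $\Lambda$ with parameter $\mu$. $L$-isothermic surfaces and Bianchi-Darboux transforms. $L$-isothermic surfaces (surfaces admitting curvature line coordinates for which the third fundamental form is conformal) are characterized as the $\Omega$-surfaces for which one of the isothermic sphere congruences, say $f^+$, admits a lightlike constant conserved quantity $c$ ($c\neq0$, $(c,c)=0$). Bianchi-Darboux transformations of $L$-isothermic surfaces coincide with the B\"acklund-type Lie-Darboux transformations, i.e. the Lie-Darboux transforms with $c\perp\hat f^+$, and the term is used here in that sense; $c$ is then also a constant conserved quantity of $\hat f^+$. Lattice. $\Lambda_{m+1,0}$ is a Bianchi-Darboux transform of $\Lambda_{m,0}$ with parameter $\alpha_m$, $\Lambda_{0,n+1}$ one of $\Lambda_{0,n}$ with parameter $\beta_n$ (all with respect to the same $c$), $\alpha_m\ne\beta_n$, and all other $f^\pm_{m,n}$ are determined by Bianchi permutability on elementary quadrilaterals, separately for the $+$ and the $-$ maps. All maps are assumed nondegenerate as needed, in particular $f^\pm_{m,n}$ is nowhere orthogonal to its lattice neighbours of the same sign. Discrete surfaces. Write $i=(m,n)$, $j=(m+1,n)$, $k=(m+1,n+1)$, $\ell=(m,n+1)$. A discrete map $F$ into $\mathbb{P}(\mathcal{L})$ with adjacent values non-orthogonal is discrete isothermic if there is a real non-vanishing edge-labeling with $m_{ij}=m_{\ell k}$, $m_{i\ell}=m_{jk}$ such that $\Gamma(t)_{ji}:=\Gamma_{F_i}^{F_j}(1-\tfrac t{m_{ij}})$ satisfies $\Gamma(t)_{kj}\Gamma(t)_{ji}=\Gamma(t)_{k\ell}\Gamma(t)_{\ell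 i}$ for all $t$ (where defined). Discrete isothermic maps $F^\pm$ with the same edge-labeling form a (discrete) isotropic Darboux pair if there are $\tau_i\in F^+_i\wedge F^-_i$ with $\Gamma^-(t)_{ji}=\exp(t\tau_j)\,\Gamma^+(t)_{ji}\,\exp(-t\tau_i)$ on all edges and all $t$ (where defined). A discrete $\Omega$-surface is a map $i\mapsto F^+_i\oplus F^-_i\in Z$ spanned by a discrete isotropic Darboux pair. It is a discrete $L$-isothermic surface if one of $F^\pm$ admits a lightlike constant conserved quantity, i.e. a nonzero null vector $c\in\mathbb{R}^{4,2}$ with $\Gamma(t)_{ji}c=c$ on all edges for all $t$ (where defined), $\Gamma(t)_{ji}$ being its discrete connections. *)

theory Defs
  imports "HOL-Analysis.Analysis"
begin

section \<open>The space of signature (4,2)\<close>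

type_synonym r42 = "(real^4) \<times> (real^2)"

definition ip :: "r42 \<Rightarrow> r42 \<Rightarrow> real" where
  "ip v w = fst v \<bullet> fst w - snd v \<bullet> snd w"

definition perp :: "r42 set \<Rightarrow> r42 set" where
  "perp a = {v. \<forall>w\<in>a. ip v w = 0}"

definition orthogonal_lines :: "r42 set \<Rightarrow> r42 set \<Rightarrow> bool" where
  "orthogonal_lines a b \<longleftrightarrow> (\<forall>v\<in>a. \<forall>w\<in>b. ip v w = 0)"

text \<open>Points of the Lie quadric are null lines; elements of \<open>Z\<close> are null 2-planes.\<close>

definition null_line :: "r42 set \<Rightarrow> bool" where
  "null_line a \<longleftrightarrow> (\<exists>v. v \<noteq> 0 \<and> ip v v = 0 \<and> a = span {v})"

definition null_plane :: "r42 set \<Rightarrow> bool" where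
  "null_plane P \<longleftrightarrow> subspace P \<and> dim P = 2 \<and> (\<forall>v\<in>P. \<forall>w\<in>P. ip v w = 0)"

text \<open>The sum of two subspaces. That a sum of lines is direct is expressed by
  requiring it to be a \<^const>\<open>null_plane\<close>.\<close>

definition plus_sub :: "r42 set \<Rightarrow> r42 set \<Rightarrow> r42 set"  (infixl \<open>\<oplus>\<^sub>s\<close> 65) where
  "a \<oplus>\<^sub>s b = {v + w | v w. v \<in> a \<and> w \<in> b}"

definition wedge :: "r42 \<Rightarrow> r42 \<Rightarrow> r42 \<Rightarrow> r42" where
  "wedge u v = (\<lambda>w. ip u w *\<^sub>R v - ip v w *\<^sub>R u)"

text \<open>The subspace \<open>a \<wedge> b\<close> of the orthogonal Lie algebra. It is only used when \<open>a\<close> is a line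
  and \<open>b\<close> a subspace, in which case every element is decomposable.\<close>

definition wedge_sub :: "r42 set \<Rightarrow> r42 set \<Rightarrow> (r42 \<Rightarrow> r42) set" where
  "wedge_sub a b = {wedge u v | u v. u \<in> a \<and> v \<in> b}"

definition op_exp :: "(r42 \<Rightarrow> r42) \<Rightarrow> r42 \<Rightarrow> r42" where
  "op_exp T v = (\<Sum>n. (T ^^ n) v /\<^sub>R fact n)"

text \<open>\<open>\<Gamma>_a^b(s)\<close>, for non-orthogonal null lines \<open>a\<close>, \<open>b\<close> and \<open>s \<noteq> 0\<close> (junk otherwise).\<close>

definition Gam :: "r42 set \<Rightarrow> r42 set \<Rightarrow> real \<Rightarrow> r42 \<Rightarrow> r42" where
  "Gam a b s = (THE T. linear T \<and> (\<forall>v\<in>b. T v = s *\<^sub>R v) \<and> (\<forall>v\<in>a. T v = inverse s *\<^sub>R v) \<and>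
                       (\<forall>v\<in>perp (a \<oplus>\<^sub>s b). T v = v))"

section \<open>Smooth surfaces\<close>

primrec Ck_on :: "nat \<Rightarrow> 'a::real_normed_vector set \<Rightarrow> ('a \<Rightarrow> 'b::real_normed_vector) \<Rightarrow> bool" where
  "Ck_on 0 S f = continuous_on S f"
| "Ck_on (Suc k) S f =
     (f differentiable_on S \<and> (\<forall>v. Ck_on k S (\<lambda>x. frechet_derivative f (at x) v)))"

text \<open>Only meant for open \<open>S\<close>.\<close>

definition smooth_on :: "'a::real_normed_vector set \<Rightarrow> ('a \<Rightarrow> 'b::real_normed_vector) \<Rightarrow> bool" where
  "smooth_on S f \<longleftrightarrow> (\<forall>k. Ck_on k S f)"

text \<open>A local parametrization \<open>(W, p)\<close> consists of a parameter domain \<open>W\<close> in the plane and the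
  inverse \<open>p\<close> of a chart; a map \<open>\<phi>\<close> on the surface has coordinate expression \<open>\<phi> \<circ> p\<close>, and
  \<open>u \<in> W\<close> together with \<open>v :: real^2\<close> represents a tangent vector at \<open>p u\<close>.\<close>

type_synonym 'a param = "(real^2) set \<times> (real^2 \<Rightarrow> 'a)"

definition transition :: "'a param \<Rightarrow> 'a param \<Rightarrow> real^2 \<Rightarrow> real^2" where
  "transition \<kappa> \<nu> = inv_into (fst \<nu>) (snd \<nu>) \<circ> snd \<kappa>"

definition overlap :: "'a param \<Rightarrow> 'a param \<Rightarrow> (real^2) set" where
  "overlap \<kappa> \<nu> = {u \<in> fst \<kappa>. snd \<kappa> u \<in> snd \<nu> ` fst \<nu>}"

text \<open>The underlying set of the surface is the whole type \<open>'a\<close>.\<close>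

definition smooth_surface :: "'a::{t2_space,second_countable_topology} param set \<Rightarrow> bool" where
  "smooth_surface A \<longleftrightarrow>
     (\<Union>(W, p)\<in>A. p ` W) = UNIV \<and>
     (\<forall>(W, p)\<in>A. open W \<and> open (p ` W) \<and> homeomorphism W (p ` W) p (inv_into W p)) \<and>
     (\<forall>\<kappa>\<in>A. \<forall>\<nu>\<in>A. smooth_on (overlap \<kappa> \<nu>) (transition \<kappa> \<nu>))"

text \<open>Local sections over \<open>U\<close> of the trivial bundle with fibre \<^typ>\<open>r42\<close>.\<close>

definition smooth_section ::
  "'a::topological_space param set \<Rightarrow> 'a set \<Rightarrow> ('a \<Rightarrow> r42) \<Rightarrow> bool" where
  "smooth_section A U \<phi> \<longleftrightarrow> (\<forall>(W, p)\<in>A. smooth_on {u\<in>W. p u \<in> U} (\<phi> \<circ> p))"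

definition differentiable_section :: "'a::topological_space param set \<Rightarrow> ('a \<Rightarrow> r42) \<Rightarrow> bool" where
  "differentiable_section A \<phi> \<longleftrightarrow> (\<forall>(W, p)\<in>A. \<forall>u\<in>W. (\<phi> \<circ> p) differentiable (at u))"

definition section_deriv :: "('a \<Rightarrow> r42) \<Rightarrow> 'a param \<Rightarrow> real^2 \<Rightarrow> real^2 \<Rightarrow> r42" where
  "section_deriv \<phi> \<kappa> u v = frechet_derivative (\<phi> \<circ> snd \<kappa>) (at u) v"

definition smooth_endo :: "'a::topological_space param set \<Rightarrow> ('a \<Rightarrow> r42 \<Rightarrow> r42) \<Rightarrow> bool" where
  "smooth_endo A \<tau> \<longleftrightarrow> (\<forall>z. smooth_section A UNIV (\<lambda>x. \<tau> x z))"

text \<open>Smooth maps into the Lie quadric, i.e. smooth null line subbundles.\<close>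

definition smooth_line_map :: "'a::topological_space param set \<Rightarrow> ('a \<Rightarrow> r42 set) \<Rightarrow> bool" where
  "smooth_line_map A f \<longleftrightarrow>
     (\<forall>x. null_line (f x)) \<and>
     (\<forall>x. \<exists>U \<sigma>. open U \<and> x \<in> U \<and> smooth_section A U \<sigma> \<and>
            (\<forall>y\<in>U. \<sigma> y \<noteq> 0 \<and> f y = span {\<sigma> y}))"

text \<open>Smooth maps into \<open>Z\<close>, i.e. smooth null subbundles of rank 2.\<close>

definition smooth_plane_map :: "'a::topological_space param set \<Rightarrow> ('a \<Rightarrow> r42 set) \<Rightarrow> bool" where
  "smooth_plane_map A \<Lambda> \<longleftrightarrow>
     (\<forall>x. null_plane (\<Lambda> x)) \<and>
     (\<forall>x. \<exists>U \<sigma> \<rho>. open U \<and> x \<in> U \<and> smooth_section A U \<sigma> \<and> smooth_section A U \<rho> \<and>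
            (\<forall>y\<in>U. \<Lambda> y = span {\<sigma> y, \<rho> y}))"

text \<open>The contact condition \<open>(d\<sigma>, \<rho>) = 0\<close> for sections of \<open>\<Lambda>\<close>, and injectivity of the differential
  \<open>d\<Lambda>(X) : \<Lambda> \<rightarrow> \<real>\<^sup>4\<^sup>,\<^sup>2 / \<Lambda>\<close>, \<open>\<sigma> \<mapsto> d\<^sub>X \<sigma> mod \<Lambda>\<close>, as a function of \<open>X\<close>.\<close>

definition legendre_immersion :: "'a::topological_space param set \<Rightarrow> ('a \<Rightarrow> r42 set) \<Rightarrow> bool" where
  "legendre_immersion A \<Lambda> \<longleftrightarrow>
     smooth_plane_map A \<Lambda> \<and>
     (\<forall>U \<sigma> \<rho>. open U \<longrightarrow> smooth_section A U \<sigma> \<longrightarrow> smooth_section A U \<rho> \<longrightarrow>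
        (\<forall>y\<in>U. \<sigma> y \<in> \<Lambda> y \<and> \<rho> y \<in> \<Lambda> y) \<longrightarrow>
        (\<forall>\<kappa>\<in>A. \<forall>u\<in>fst \<kappa>. \<forall>v. snd \<kappa> u \<in> U \<longrightarrow>
           ip (section_deriv \<sigma> \<kappa> u v) (\<rho> (snd \<kappa> u)) = 0)) \<and>
     (\<forall>\<kappa>\<in>A. \<forall>u\<in>fst \<kappa>. \<forall>v. v \<noteq> 0 \<longrightarrow>
        (\<exists>U \<sigma>. open U \<and> snd \<kappa> u \<in> U \<and> smooth_section A U \<sigma> \<and> (\<forall>y\<in>U. \<sigma> y \<in> \<Lambda> y) \<and>
               section_deriv \<sigma> \<kappa> u v \<notin> \<Lambda> (snd \<kappa> u)))"

section \<open>Endomorphism-valued 1-forms and connections\<close>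

text \<open>\<open>\<eta> \<kappa> u v\<close> is the value of the form on the tangent vector that \<open>v\<close> represents at \<open>u\<close> in the
  parametrization \<open>\<kappa>\<close>.\<close>

type_synonym 'a one_form = "'a param \<Rightarrow> real^2 \<Rightarrow> real^2 \<Rightarrow> r42 \<Rightarrow> r42"

definition smooth_one_form :: "'a::topological_space param set \<Rightarrow> 'a one_form \<Rightarrow> bool" where
  "smooth_one_form A \<eta> \<longleftrightarrow>
     (\<forall>\<kappa>\<in>A. \<forall>u\<in>fst \<kappa>. (\<forall>v. linear (\<eta> \<kappa> u v)) \<and> (\<forall>z. linear (\<lambda>v. \<eta> \<kappa> u v z))) \<and>
     (\<forall>\<kappa>\<in>A. \<forall>v z. smooth_on (fst \<kappa>) (\<lambda>u. \<eta> \<kappa> u v z)) \<and>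
     (\<forall>\<kappa>\<in>A. \<forall>\<nu>\<in>A. \<forall>u\<in>overlap \<kappa> \<nu>. \<forall>v.
        \<eta> \<nu> (transition \<kappa> \<nu> u) (frechet_derivative (transition \<kappa> \<nu>) (at u) v) = \<eta> \<kappa> u v)"

definition closed_form :: "'a::topological_space param set \<Rightarrow> 'a one_form \<Rightarrow> bool" where
  "closed_form A \<eta> \<longleftrightarrow>
     (\<forall>\<kappa>\<in>A. \<forall>u\<in>fst \<kappa>. \<forall>v w z.
        frechet_derivative (\<lambda>u. \<eta> \<kappa> u w z) (at u) v =
        frechet_derivative (\<lambda>u. \<eta> \<kappa> u v z) (at u) w)"

definition nowhere_zero_form :: "'a::topological_space param set \<Rightarrow> 'a one_form \<Rightarrow> bool" where
  "nowhere_zero_form A \<eta> \<longleftrightarrow> (\<forall>\<kappa>\<in>A. \<forall>u\<in>fst \<kappa>. \<exists>v z. \<eta> \<kappa> u v z \<noteq> 0)"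

text \<open>Connections on the trivial bundle, as operators sending a section and a tangent vector to
  the covariant derivative.\<close>

type_synonym 'a connection = "('a \<Rightarrow> r42) \<Rightarrow> 'a param \<Rightarrow> real^2 \<Rightarrow> real^2 \<Rightarrow> r42"

definition conn :: "'a one_form \<Rightarrow> real \<Rightarrow> 'a connection" where
  "conn \<eta> t \<phi> \<kappa> u v = section_deriv \<phi> \<kappa> u v + t *\<^sub>R \<eta> \<kappa> u v (\<phi> (snd \<kappa> u))"

text \<open>The connection \<open>G \<circ> D \<circ> H\<close>, where \<open>H\<close> will be the pointwise inverse of \<open>G\<close>.\<close>

definition gauge ::
  "('a \<Rightarrow> r42 \<Rightarrow> r42) \<Rightarrow> 'a connection \<Rightarrow> ('a \<Rightarrow> r42 \<Rightarrow> r42) \<Rightarrow> 'a connection" where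
  "gauge G D H \<phi> \<kappa> u v = G (snd \<kappa> u) (D (\<lambda>y. H y (\<phi> y)) \<kappa> u v)"

text \<open>Both sides are first order operators, so it makes no difference whether they are compared
  on smooth or on differentiable sections.\<close>

definition conn_eq :: "'a::topological_space param set \<Rightarrow> 'a connection \<Rightarrow> 'a connection \<Rightarrow> bool" where
  "conn_eq A D D' \<longleftrightarrow>
     (\<forall>\<phi>. differentiable_section A \<phi> \<longrightarrow>
        (\<forall>\<kappa>\<in>A. \<forall>u\<in>fst \<kappa>. \<forall>v. D \<phi> \<kappa> u v = D' \<phi> \<kappa> u v))"

definition parallel_line ::
  "'a::topological_space param set \<Rightarrow> 'a connection \<Rightarrow> ('a \<Rightarrow> r42 set) \<Rightarrow> bool" where
  "parallel_line A D f \<longleftrightarrow>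
     (\<forall>U \<sigma>. open U \<longrightarrow> smooth_section A U \<sigma> \<longrightarrow> (\<forall>y\<in>U. \<sigma> y \<in> f y) \<longrightarrow>
        (\<forall>\<kappa>\<in>A. \<forall>u\<in>fst \<kappa>. \<forall>v. snd \<kappa> u \<in> U \<longrightarrow> D \<sigma> \<kappa> u v \<in> f (snd \<kappa> u)))"

section \<open>Isothermic maps and their Darboux transforms\<close>

text \<open>Since \<open>\<eta>\<close> takes values in \<open>f \<wedge> f\<^sup>\<bottom>\<close>, closedness already makes all connections
  \<^term>\<open>conn \<eta> t\<close> flat.\<close>

definition isothermic ::
  "'a::topological_space param set \<Rightarrow> ('a \<Rightarrow> r42 set) \<Rightarrow> 'a one_form \<Rightarrow> bool" where
  "isothermic A f \<eta> \<longleftrightarrow>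
     smooth_line_map A f \<and> smooth_one_form A \<eta> \<and>
     (\<forall>\<kappa>\<in>A. \<forall>u\<in>fst \<kappa>. \<forall>v. \<eta> \<kappa> u v \<in> wedge_sub (f (snd \<kappa> u)) (perp (f (snd \<kappa> u)))) \<and>
     closed_form A \<eta> \<and> nowhere_zero_form A \<eta>"

text \<open>\<open>g\<close> is a Darboux transform of \<open>f\<close> with parameter \<open>\<mu>\<close>, and \<open>\<theta>\<close> is the form that it carries
  as an isothermic map, determined by its connections.\<close>

definition darboux_transform ::
  "'a::topological_space param set \<Rightarrow> ('a \<Rightarrow> r42 set) \<Rightarrow> 'a one_form \<Rightarrow>
   ('a \<Rightarrow> r42 set) \<Rightarrow> 'a one_form \<Rightarrow> real \<Rightarrow> bool" where
  "darboux_transform A f \<eta> g \<theta> \<mu> \<longleftrightarrow>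
     \<mu> \<noteq> 0 \<and> smooth_line_map A g \<and> (\<forall>x. \<not> orthogonal_lines (f x) (g x)) \<and>
     parallel_line A (conn \<eta> \<mu>) g \<and>
     (\<forall>t. t \<noteq> \<mu> \<longrightarrow>
        conn_eq A (conn \<theta> t)
          (gauge (\<lambda>x. Gam (f x) (g x) (1 - t / \<mu>)) (conn \<eta> t)
                 (\<lambda>x. inv (Gam (f x) (g x) (1 - t / \<mu>)))))"

definition conserved_quantity ::
  "'a::topological_space param set \<Rightarrow> 'a one_form \<Rightarrow> r42 \<Rightarrow> bool" where
  "conserved_quantity A \<eta> c \<longleftrightarrow>
     c \<noteq> 0 \<and> (\<forall>t. \<forall>\<kappa>\<in>A. \<forall>u\<in>fst \<kappa>. \<forall>v. conn \<eta> t (\<lambda>_. c) \<kappa> u v = 0)"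

text \<open>\<open>f\<^sub>k\<close> is obtained by Bianchi permutability from \<open>f\<^sub>i\<close>, \<open>f\<^sub>j\<close>, \<open>f\<^sub>\<ell>\<close>; the arguments \<open>a\<close> and \<open>b\<close> are
  \<open>m\<^sub>i\<^sub>j\<close> and \<open>m\<^sub>i\<^sub>\<ell>\<close>. The second expression for \<open>f\<^sub>k\<close>, with the roles of \<open>j\<close> and \<open>\<ell>\<close> exchanged, agrees with
  this one.\<close>

definition bianchi_permuted ::
  "('a \<Rightarrow> r42 set) \<Rightarrow> ('a \<Rightarrow> r42 set) \<Rightarrow> ('a \<Rightarrow> r42 set) \<Rightarrow> ('a \<Rightarrow> r42 set) \<Rightarrow>
   real \<Rightarrow> real \<Rightarrow> bool" where
  "bianchi_permuted fi fj fk fl a b \<longleftrightarrow> (\<forall>x. fk x = Gam (fi x) (fj x) (1 - b / a) ` fl x)"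

section \<open>\<open>\<Omega>\<close>-surfaces, \<open>L\<close>-isothermic surfaces and their transformations\<close>

definition isotropic_gauge ::
  "'a::topological_space param set \<Rightarrow> ('a \<Rightarrow> r42 set) \<Rightarrow> 'a one_form \<Rightarrow>
   ('a \<Rightarrow> r42 set) \<Rightarrow> 'a one_form \<Rightarrow> ('a \<Rightarrow> r42 \<Rightarrow> r42) \<Rightarrow> bool" where
  "isotropic_gauge A fp \<eta>p fm \<eta>m \<tau> \<longleftrightarrow>
     smooth_endo A \<tau> \<and> (\<forall>x. \<tau> x \<in> wedge_sub (fp x) (fm x)) \<and>
     (\<forall>t. conn_eq A (conn \<eta>m t)
            (gauge (\<lambda>x. op_exp (\<lambda>z. t *\<^sub>R \<tau> x z)) (conn \<eta>p t)
                   (\<lambda>x. op_exp (\<lambda>z. (- t) *\<^sub>R \<tau> x z))))"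

definition isotropic_darboux_pair ::
  "'a::topological_space param set \<Rightarrow> ('a \<Rightarrow> r42 set) \<Rightarrow> 'a one_form \<Rightarrow>
   ('a \<Rightarrow> r42 set) \<Rightarrow> 'a one_form \<Rightarrow> bool" where
  "isotropic_darboux_pair A fp \<eta>p fm \<eta>m \<longleftrightarrow>
     isothermic A fp \<eta>p \<and> isothermic A fm \<eta>m \<and> (\<exists>\<tau>. isotropic_gauge A fp \<eta>p fm \<eta>m \<tau>)"

definition omega_surface ::
  "'a::topological_space param set \<Rightarrow> ('a \<Rightarrow> r42 set) \<Rightarrow> 'a one_form \<Rightarrow>
   ('a \<Rightarrow> r42 set) \<Rightarrow> 'a one_form \<Rightarrow> bool" where
  "omega_surface A fp \<eta>p fm \<eta>m \<longleftrightarrow>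
     isotropic_darboux_pair A fp \<eta>p fm \<eta>m \<and> legendre_immersion A (\<lambda>x. fp x \<oplus>\<^sub>s fm x)"

text \<open>The \<open>\<Omega>\<close>-surface \<open>f\<^sup>+ \<oplus> f\<^sup>-\<close> is \<open>L\<close>-isothermic, \<open>c\<close> being a lightlike constant conserved
  quantity of \<open>f\<^sup>+\<close>.\<close>

definition L_isothermic ::
  "'a::topological_space param set \<Rightarrow> ('a \<Rightarrow> r42 set) \<Rightarrow> 'a one_form \<Rightarrow>
   ('a \<Rightarrow> r42 set) \<Rightarrow> 'a one_form \<Rightarrow> r42 \<Rightarrow> bool" where
  "L_isothermic A fp \<eta>p fm \<eta>m c \<longleftrightarrow>
     omega_surface A fp \<eta>p fm \<eta>m \<and> ip c c = 0 \<and> conserved_quantity A \<eta>p c"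

text \<open>\<open>gp \<oplus> gm\<close> is a Lie-Darboux transform of the \<open>\<Omega>\<close>-surface \<open>fp \<oplus> fm\<close>. On an \<open>\<Omega>\<close>-surface
  the gauge \<open>\<tau>\<close> is unique, so that the choice of \<open>\<tau>\<close> is immaterial.\<close>

definition lie_darboux_transform ::
  "'a::topological_space param set \<Rightarrow>
   ('a \<Rightarrow> r42 set) \<Rightarrow> 'a one_form \<Rightarrow> ('a \<Rightarrow> r42 set) \<Rightarrow> 'a one_form \<Rightarrow>
   ('a \<Rightarrow> r42 set) \<Rightarrow> 'a one_form \<Rightarrow> ('a \<Rightarrow> r42 set) \<Rightarrow> 'a one_form \<Rightarrow> real \<Rightarrow> bool" where
  "lie_darboux_transform A fp \<eta>p fm \<eta>m gp \<theta>p gm \<theta>m \<mu> \<longleftrightarrow>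
     omega_surface A fp \<eta>p fm \<eta>m \<and>
     darboux_transform A fp \<eta>p gp \<theta>p \<mu> \<and>
     (\<exists>\<tau>. isotropic_gauge A fp \<eta>p fm \<eta>m \<tau> \<and>
          (\<forall>x. gm x = op_exp (\<lambda>z. \<mu> *\<^sub>R \<tau> x z) ` gp x)) \<and>
     darboux_transform A fm \<eta>m gm \<theta>m \<mu> \<and>
     isotropic_darboux_pair A gp \<theta>p gm \<theta>m"

definition bianchi_darboux_transform ::
  "'a::topological_space param set \<Rightarrow> r42 \<Rightarrow>
   ('a \<Rightarrow> r42 set) \<Rightarrow> 'a one_form \<Rightarrow> ('a \<Rightarrow> r42 set) \<Rightarrow> 'a one_form \<Rightarrow>
   ('a \<Rightarrow> r42 set) \<Rightarrow> 'a one_form \<Rightarrow> ('a \<Rightarrow> r42 set) \<Rightarrow> 'a one_form \<Rightarrow> real \<Rightarrow> bool" where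
  "bianchi_darboux_transform A c fp \<eta>p fm \<eta>m gp \<theta>p gm \<theta>m \<mu> \<longleftrightarrow>
     lie_darboux_transform A fp \<eta>p fm \<eta>m gp \<theta>p gm \<theta>m \<mu> \<and> (\<forall>x. c \<in> perp (gp x))"

section \<open>Discrete surfaces\<close>

text \<open>Edge-labelings are split into the labels \<open>a m n\<close> of the edges from \<open>(m, n)\<close> to \<open>(m + 1, n)\<close>
  and \<open>b m n\<close> of the edges from \<open>(m, n)\<close> to \<open>(m, n + 1)\<close>. Conditions on edges are imposed in this
  orientation only: since \<open>\<Gamma>_B^A(s)\<close> is the inverse of \<open>\<Gamma>_A^B(s)\<close>, those for the opposite orientation
  are equivalent. The connections are defined for \<open>t\<close> different from the labels.\<close>

definition edge_labeling :: "(nat \<Rightarrow> nat \<Rightarrow> real) \<Rightarrow> (nat \<Rightarrow> nat \<Rightarrow> real) \<Rightarrow> bool" where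
  "edge_labeling a b \<longleftrightarrow>
     (\<forall>m n. a m n \<noteq> 0 \<and> b m n \<noteq> 0 \<and> a m n = a m (Suc n) \<and> b m n = b (Suc m) n)"

definition dconn :: "r42 set \<Rightarrow> r42 set \<Rightarrow> real \<Rightarrow> real \<Rightarrow> r42 \<Rightarrow> r42" where
  "dconn Fi Fj mij t = Gam Fi Fj (1 - t / mij)"

definition discrete_isothermic ::
  "(nat \<Rightarrow> nat \<Rightarrow> r42 set) \<Rightarrow> (nat \<Rightarrow> nat \<Rightarrow> real) \<Rightarrow> (nat \<Rightarrow> nat \<Rightarrow> real) \<Rightarrow> bool" where
  "discrete_isothermic F a b \<longleftrightarrow>
     edge_labeling a b \<and>
     (\<forall>m n. null_line (F m n) \<and> \<not> orthogonal_lines (F m n) (F (Suc m) n) \<and>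
            \<not> orthogonal_lines (F m n) (F m (Suc n))) \<and>
     (\<forall>m n t. t \<noteq> a m n \<longrightarrow> t \<noteq> b m n \<longrightarrow>
        dconn (F (Suc m) n) (F (Suc m) (Suc n)) (b (Suc m) n) t \<circ>
          dconn (F m n) (F (Suc m) n) (a m n) t =
        dconn (F m (Suc n)) (F (Suc m) (Suc n)) (a m (Suc n)) t \<circ>
          dconn (F m n) (F m (Suc n)) (b m n) t)"

definition discrete_isotropic_darboux_pair ::
  "(nat \<Rightarrow> nat \<Rightarrow> r42 set) \<Rightarrow> (nat \<Rightarrow> nat \<Rightarrow> r42 set) \<Rightarrow>
   (nat \<Rightarrow> nat \<Rightarrow> real) \<Rightarrow> (nat \<Rightarrow> nat \<Rightarrow> real) \<Rightarrow> bool" where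
  "discrete_isotropic_darboux_pair Fp Fm a b \<longleftrightarrow>
     discrete_isothermic Fp a b \<and> discrete_isothermic Fm a b \<and>
     (\<exists>\<tau>. (\<forall>m n. \<tau> m n \<in> wedge_sub (Fp m n) (Fm m n)) \<and>
        (\<forall>m n t. t \<noteq> a m n \<longrightarrow>
           dconn (Fm m n) (Fm (Suc m) n) (a m n) t =
           op_exp (\<lambda>z. t *\<^sub>R \<tau> (Suc m) n z) \<circ> dconn (Fp m n) (Fp (Suc m) n) (a m n) t \<circ>
             op_exp (\<lambda>z. (- t) *\<^sub>R \<tau> m n z)) \<and>
        (\<forall>m n t. t \<noteq> b m n \<longrightarrow>
           dconn (Fm m n) (Fm m (Suc n)) (b m n) t =
           op_exp (\<lambda>z. t *\<^sub>R \<tau> m (Suc n) z) \<circ> dconn (Fp m n) (Fp m (Suc n)) (b m n) t \<circ>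
             op_exp (\<lambda>z. (- t) *\<^sub>R \<tau> m n z)))"

definition discrete_conserved_quantity ::
  "(nat \<Rightarrow> nat \<Rightarrow> r42 set) \<Rightarrow> (nat \<Rightarrow> nat \<Rightarrow> real) \<Rightarrow> (nat \<Rightarrow> nat \<Rightarrow> real) \<Rightarrow> r42 \<Rightarrow> bool" where
  "discrete_conserved_quantity F a b c \<longleftrightarrow>
     c \<noteq> 0 \<and>
     (\<forall>m n t. t \<noteq> a m n \<longrightarrow> dconn (F m n) (F (Suc m) n) (a m n) t c = c) \<and>
     (\<forall>m n t. t \<noteq> b m n \<longrightarrow> dconn (F m n) (F m (Suc n)) (b m n) t c = c)"

text \<open>The data exhibiting \<open>\<Lambda>\<close> as a discrete \<open>\<Omega>\<close>-surface.\<close>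

definition discrete_omega_spanned ::
  "(nat \<Rightarrow> nat \<Rightarrow> r42 set) \<Rightarrow> (nat \<Rightarrow> nat \<Rightarrow> r42 set) \<Rightarrow> (nat \<Rightarrow> nat \<Rightarrow> r42 set) \<Rightarrow>
   (nat \<Rightarrow> nat \<Rightarrow> real) \<Rightarrow> (nat \<Rightarrow> nat \<Rightarrow> real) \<Rightarrow> bool" where
  "discrete_omega_spanned \<Lambda> Fp Fm a b \<longleftrightarrow>
     discrete_isotropic_darboux_pair Fp Fm a b \<and>
     (\<forall>m n. null_plane (\<Lambda> m n) \<and> \<Lambda> m n = Fp m n \<oplus>\<^sub>s Fm m n)"

definition discrete_L_isothermic :: "(nat \<Rightarrow> nat \<Rightarrow> r42 set) \<Rightarrow> bool" where
  "discrete_L_isothermic \<Lambda> \<longleftrightarrow>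
     (\<exists>Fp Fm a b. discrete_omega_spanned \<Lambda> Fp Fm a b \<and>
        (\<exists>c. ip c c = 0 \<and>
             (discrete_conserved_quantity Fp a b c \<or> discrete_conserved_quantity Fm a b c)))"

end

theory Submission
  imports Defs
begin

text \<open>
  Over a fixed point of the surface all claims are linear algebra in \<open>\<real>\<^sup>4\<^sup>,\<^sup>2\<close>, once the endomorphisms \<open>\<tau>\<close>
  are known on the boundary of the lattice. The discrete connections are the maps
  \<open>\<Gamma>(t)\<^sub>j\<^sub>i = \<Gamma>_{f\<^sub>i}^{f\<^sub>j}(1 - t/m\<^sub>i\<^sub>j)\<close> that relate the smooth connections of neighbouring isothermic
  maps, and on the boundary the discrete \<open>\<tau>\<close> consists of the values of the smooth ones.

  \<^item> Edges (\<open>isotropic_edge_exists\<close>). Given \<open>\<tau>\<^sub>i\<close> in \<open>f\<^sub>i\<^sup>+ \<and> f\<^sub>i\<^sup>-\<close> and \<open>f\<^sub>j\<^sup>- = exp(\<mu>\<tau>\<^sub>i) f\<^sub>j\<^sup>+\<close>, there is an explicit \<open>\<tau>\<^sub>j\<close> in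
    \<open>f\<^sub>j\<^sup>+ \<and> f\<^sub>j\<^sup>-\<close> with \<open>\<Gamma>\<^sup>-(t)\<^sub>j\<^sub>i = exp(t\<tau>\<^sub>j) \<Gamma>\<^sup>+(t)\<^sub>j\<^sub>i exp(-t\<tau>\<^sub>i)\<close>. It is determined by this relation at
    any single \<open>t\<close> other than \<open>0\<close> and \<open>\<mu>\<close>.

  \<^item> Squares (\<open>bianchi_square\<close>, \<open>isotropic_square\<close>). The connections commute around a Bianchi
    quadrilateral, so the two edges leading to the fourth vertex yield the same \<open>\<tau>\<^sub>k\<close>. By induction
    over the lattice \<open>\<tau>\<close> extends from the boundary to all vertices (\<open>isotropic_lattice\<close>), and with it
    the property that \<open>f\<^sup>+ \<oplus> f\<^sup>-\<close> is a null plane.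

  \<^item> Boundary (\<open>lie_darboux_edge\<close>). On the boundary each surface comes with its own smooth gauge, and
    the transported \<open>\<tau>\<^sub>j\<close> has to coincide with it, since the next transform is defined by it.
    The transported \<open>\<tau>\<^sub>j\<close> gauges the connections of the transformed pair into each other
    (\<open>darboux_transform_gauge\<close>), and an \<open>\<Omega>\<close>-surface has only one gauge (\<open>gauge_unique\<close>): its derivative is
    \<open>\<eta>\<^sup>+ - \<eta>\<^sup>-\<close>, so two gauges differ by a locally constant map, and where that is nonzero the Legendre
    map would be locally constant.

  \<^item> Conserved quantity. The vector \<open>c\<close> is orthogonal to \<open>f\<^sup>+\<close> at the corner because \<open>\<eta>\<^sup>+ c = 0\<close> and \<open>\<eta>\<^sup>+\<close>
    has no zeros, along the boundary by the definition of Bianchi-Darboux transforms, and elsewhere because the fourth line of a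
    Bianchi quadrilateral lies in the span of the other three. A vector orthogonal to both ends of
    an edge is fixed by \<open>\<Gamma>(t)\<^sub>j\<^sub>i\<close>.
\<close>

section \<open>The inner product and the operators wedge and exp\<close>

lemma ip_commute: "ip x y = ip y x"
  by (simp add: ip_def inner_commute)

lemma ip_add_left: "ip (x + y) z = ip x z + ip y z"
  and ip_add_right: "ip z (x + y) = ip z x + ip z y"
  and ip_diff_left: "ip (x - y) z = ip x z - ip y z"
  and ip_diff_right: "ip z (x - y) = ip z x - ip z y"
  and ip_scale_left: "ip (r *\<^sub>R x) z = r * ip x z"
  and ip_scale_right: "ip z (r *\<^sub>R x) = r * ip z x"
  and ip_zero_left: "ip 0 z = 0"
  and ip_zero_right: "ip z 0 = 0"
  by (simp_all add: ip_def algebra_simps)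

lemmas ip_bilinear = ip_add_left ip_add_right ip_diff_left ip_diff_right
  ip_scale_left ip_scale_right ip_zero_left ip_zero_right

lemma bounded_bilinear_ip: "bounded_bilinear ip"
proof -
  have "bounded_linear (\<lambda>w::r42. (fst w, - snd w))"
    by (intro bounded_linear_Pair bounded_linear_fst bounded_linear_minus bounded_linear_snd)
  then have "bounded_bilinear (\<lambda>v w::r42. v \<bullet> (fst w, - snd w))"
    using bounded_bilinear.comp[OF bounded_bilinear_inner bounded_linear_ident] by blast
  moreover have "ip = (\<lambda>v w. v \<bullet> (fst w, - snd w))"
    by (intro ext) (simp add: ip_def inner_prod_def)
  ultimately show ?thesis by simp
qed

lemma mem_line: "x \<in> span {u} \<longleftrightarrow> (\<exists>r. x = r *\<^sub>R u)"
  unfolding span_singleton image_def by simp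

lemma plus_sub_lines: "span {u} \<oplus>\<^sub>s span {v} = span {u, v}"
  using span_Un[of "{u}" "{v}"] by (simp only: plus_sub_def insert_is_Un[symmetric])

lemma mem_plus_sub_lines: "x \<in> span {u} \<oplus>\<^sub>s span {v} \<longleftrightarrow> (\<exists>a b. x = a *\<^sub>R u + b *\<^sub>R v)"
proof
  assume "x \<in> span {u} \<oplus>\<^sub>s span {v}"
  then obtain y z where "x = y + z" "y \<in> span {u}" "z \<in> span {v}"
    unfolding plus_sub_def by blast
  then show "\<exists>a b. x = a *\<^sub>R u + b *\<^sub>R v"
    unfolding mem_line by metis
next
  assume "\<exists>a b. x = a *\<^sub>R u + b *\<^sub>R v"
  then show "x \<in> span {u} \<oplus>\<^sub>s span {v}"
    unfolding plus_sub_def using span_base span_scale by blast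
qed

lemma linear_wedge: "linear (wedge u v)"
  by (rule linearI) (simp_all add: wedge_def ip_bilinear algebra_simps)

lemma wedge_scale_right: "wedge u (r *\<^sub>R v) = (\<lambda>z. r *\<^sub>R wedge u v z)"
  by (rule ext) (simp add: wedge_def ip_bilinear algebra_simps)

lemma wedge_scale_left: "wedge (r *\<^sub>R u) v = (\<lambda>z. r *\<^sub>R wedge u v z)"
  by (rule ext) (simp add: wedge_def ip_bilinear algebra_simps)

text \<open>An element of the exterior square of a null plane maps into the plane and kills it, so its
  exponential series stops after the linear term.\<close>

lemma wedge_square:
  assumes "ip u u = 0" "ip u v = 0" "ip v v = 0"
  shows "wedge u v (wedge u v z) = 0"
  using assms ip_commute[of v u] by (simp add: wedge_def ip_bilinear)

lemma op_exp_wedge: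
  assumes "ip u u = 0" "ip u v = 0" "ip v v = 0"
  shows "op_exp (\<lambda>z. t *\<^sub>R wedge u v z) = (\<lambda>z. z + t *\<^sub>R wedge u v z)"
proof
  fix z
  let ?T = "\<lambda>z. t *\<^sub>R wedge u v z"
  have TT: "?T (?T y) = 0" for y
    using wedge_square[OF assms] by (simp add: linear_cmul[OF linear_wedge])
  have "(?T ^^ n) z = 0" if "n \<notin> {0, 1}" for n
  proof -
    obtain k where k: "n = Suc (Suc k)"
      using \<open>n \<notin> {0, 1}\<close> by (metis insertCI not0_implies_Suc One_nat_def)
    then show ?thesis
      using TT by (simp only: k funpow.simps o_def)
  qed
  then have "op_exp ?T z = (\<Sum>n\<in>{0, 1}. (?T ^^ n) z /\<^sub>R fact n)"
    unfolding op_exp_def by (intro suminf_finite) auto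
  then show "op_exp ?T z = z + t *\<^sub>R wedge u v z"
    by simp
qed

section \<open>The orthogonal maps in terms of generators\<close>

text \<open>\<open>\<Gamma>_a^b(s)\<close> written in terms of generators \<open>u\<close> of \<open>a\<close> and \<open>w\<close> of \<open>b\<close>. The formula does not depend
  on the scaling of the generators.\<close>

definition boost :: "r42 \<Rightarrow> r42 \<Rightarrow> real \<Rightarrow> r42 \<Rightarrow> r42" where
  "boost u w s x = x + ((inverse s - 1) * ip w x / ip u w) *\<^sub>R u + ((s - 1) * ip u x / ip u w) *\<^sub>R w"

lemma linear_boost: "linear (boost u w s)"
  by (rule linearI) (simp_all add: boost_def ip_bilinear algebra_simps add_divide_distrib diff_divide_distrib)

lemma Gam_span:
  assumes "ip u u = 0" "ip w w = 0" "ip u w \<noteq> 0" "s \<noteq> 0"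
  shows "Gam (span {u}) (span {w}) s = boost u w s"
  unfolding Gam_def
proof (rule the_equality)
  have wu: "ip w u = ip u w" by (rule ip_commute)
  have p: "v \<in> perp (span {u} \<oplus>\<^sub>s span {w}) \<longleftrightarrow> ip u v = 0 \<and> ip w v = 0" for v
  proof
    assume v: "v \<in> perp (span {u} \<oplus>\<^sub>s span {w})"
    have "u \<in> span {u} \<oplus>\<^sub>s span {w}" "w \<in> span {u} \<oplus>\<^sub>s span {w}"
      by (simp_all add: plus_sub_lines span_base)
    with v show "ip u v = 0 \<and> ip w v = 0"
      by (simp add: perp_def ip_commute[of u v] ip_commute[of w v])
  next
    assume v: "ip u v = 0 \<and> ip w v = 0"
    then have vu: "ip v u = 0" "ip v w = 0" by (simp_all add: ip_commute)
    show "v \<in> perp (span {u} \<oplus>\<^sub>s span {w})"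
      unfolding perp_def mem_Collect_eq
    proof
      fix y assume "y \<in> span {u} \<oplus>\<^sub>s span {w}"
      then obtain a b where "y = a *\<^sub>R u + b *\<^sub>R w"
        unfolding mem_plus_sub_lines by (elim exE)
      with vu show "ip v y = 0" by (simp add: ip_bilinear)
    qed
  qed
  show "linear (boost u w s) \<and> (\<forall>v\<in>span {w}. boost u w s v = s *\<^sub>R v) \<and>
        (\<forall>v\<in>span {u}. boost u w s v = inverse s *\<^sub>R v) \<and>
        (\<forall>v\<in>perp (span {u} \<oplus>\<^sub>s span {w}). boost u w s v = v)"
  proof (intro conjI ballI)
    show "linear (boost u w s)" by (rule linear_boost)
    have "boost u w s w = w + (s - 1) *\<^sub>R w" "boost u w s u = u + (inverse s - 1) *\<^sub>R u"
      using assms by (simp_all add: boost_def wu)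
    then have b: "boost u w s w = s *\<^sub>R w" "boost u w s u = inverse s *\<^sub>R u"
      by (simp_all add: algebra_simps)
    show "boost u w s v = s *\<^sub>R v" if "v \<in> span {w}" for v
    proof -
      obtain k where "v = k *\<^sub>R w" using \<open>v \<in> span {w}\<close> unfolding mem_line by blast
      then have "boost u w s v = k *\<^sub>R boost u w s w"
        by (simp only: linear_cmul[OF linear_boost])
      then show ?thesis unfolding b \<open>v = k *\<^sub>R w\<close> by (simp only: scaleR_scaleR mult.commute)
    qed
    show "boost u w s v = inverse s *\<^sub>R v" if "v \<in> span {u}" for v
    proof -
      obtain k where "v = k *\<^sub>R u" using \<open>v \<in> span {u}\<close> unfolding mem_line by blast
      then have "boost u w s v = k *\<^sub>R boost u w s u"
        by (simp only: linear_cmul[OF linear_boost])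
      then show ?thesis unfolding b \<open>v = k *\<^sub>R u\<close> by (simp only: scaleR_scaleR mult.commute)
    qed
    show "boost u w s v = v" if "v \<in> perp (span {u} \<oplus>\<^sub>s span {w})" for v
      using that by (simp add: p boost_def)
  qed
  fix T
  assume "linear T \<and> (\<forall>v\<in>span {w}. T v = s *\<^sub>R v) \<and>
        (\<forall>v\<in>span {u}. T v = inverse s *\<^sub>R v) \<and>
        (\<forall>v\<in>perp (span {u} \<oplus>\<^sub>s span {w}). T v = v)"
  note T = this[THEN conjunct1] this[THEN conjunct2, THEN conjunct1]
    this[THEN conjunct2, THEN conjunct2, THEN conjunct1] this[THEN conjunct2, THEN conjunct2, THEN conjunct2]
  show "T = boost u w s"
  proof
    fix x
    define a b where "a = ip w x / ip u w" and "b = ip u x / ip u w"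
    define y where "y = x - a *\<^sub>R u - b *\<^sub>R w"
    have "y \<in> perp (span {u} \<oplus>\<^sub>s span {w})"
      using assms(1-3) by (simp add: p y_def a_def b_def ip_bilinear wu)
    then have y: "T y = y" by (rule T(4)[rule_format])
    have T_uw: "T u = inverse s *\<^sub>R u" "T w = s *\<^sub>R w"
      by (rule T(2,3)[rule_format], rule span_base, rule singletonI)+
    have "x = y + a *\<^sub>R u + b *\<^sub>R w" by (simp add: y_def)
    then have "T x = y + a *\<^sub>R inverse s *\<^sub>R u + b *\<^sub>R s *\<^sub>R w"
      by (simp only: linear_add[OF T(1)] linear_cmul[OF T(1)] y T_uw)
    then show "T x = boost u w s x"
      by (simp add: boost_def y_def a_def b_def algebra_simps diff_divide_distrib)
  qed
qed

lemma boost_boost: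
  assumes "ip u u = 0" "ip w w = 0" "ip u w \<noteq> 0" "s \<noteq> 0" "r \<noteq> 0"
  shows "boost u w s (boost u w r x) = boost u w (s * r) x"
proof -
  have "ip w u = ip u w" by (rule ip_commute)
  with assms have "ip u (boost u w r x) = r * ip u x" "ip w (boost u w r x) = inverse r * ip w x"
    by (simp_all add: boost_def ip_bilinear left_diff_distrib right_diff_distrib diff_divide_distrib)
  then have "boost u w s (boost u w r x) = boost u w r x + ((inverse s - 1) * (inverse r * ip w x) / ip u w) *\<^sub>R u +
     ((s - 1) * (r * ip u x) / ip u w) *\<^sub>R w"
    by (simp add: boost_def[of u w s])
  then show ?thesis
    by (simp add: boost_def algebra_simps diff_divide_distrib)
qed

lemma boost_one: "boost u w 1 x = x"
  by (simp add: boost_def)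

text \<open>Here \<open>u\<close>, \<open>v\<close>, \<open>w\<close> generate \<open>f\<^sub>i\<^sup>+\<close>, \<open>f\<^sub>i\<^sup>-\<close>, \<open>f\<^sub>j\<^sup>+\<close>, and \<open>\<tau>\<^sub>i = u \<and> v\<close>. Then \<open>w' = exp(\<mu>\<tau>\<^sub>i) w\<close> generates
  \<open>f\<^sub>j\<^sup>-\<close>, and the identity says \<open>\<Gamma>\<^sup>-(t)\<^sub>j\<^sub>i exp(t\<tau>\<^sub>i) = exp(t\<tau>\<^sub>j) \<Gamma>\<^sup>+(t)\<^sub>j\<^sub>i\<close> for \<open>\<tau>\<^sub>j = w \<and> w' / (\<mu>\<^sup>2 (v, w))\<close>.
  The factor of \<open>\<tau>\<^sub>j\<close> can be read off by testing on vectors orthogonal to \<open>u\<close> and \<open>v\<close>. In general both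
  sides are \<open>x\<close> plus combinations of \<open>u\<close>, \<open>v\<close>, \<open>w\<close> with coefficients in the products of \<open>x\<close> with
  these three vectors, and the coefficients agree.\<close>

lemma edge_identity:
  assumes null: "ip u u = 0" "ip u v = 0" "ip v v = 0" "ip w w = 0"
    and uw: "ip u w = 1" and vw: "ip v w = q" "q \<noteq> 0"
    and \<mu>: "\<mu> \<noteq> 0" "t \<noteq> \<mu>"
    and w': "w' = w + \<mu> *\<^sub>R (v - q *\<^sub>R u)"
  shows "boost v w' (1 - t / \<mu>) (x + t *\<^sub>R wedge u v x) =
         boost u w (1 - t / \<mu>) x +
         t *\<^sub>R wedge w ((1 / (\<mu>^2 * q)) *\<^sub>R w') (boost u w (1 - t / \<mu>) x)"
    (is "?L = ?R")
proof -
  define s where "s = 1 - t / \<mu>"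
  have s0: "s \<noteq> 0" using \<mu> by (simp add: s_def)
  have t: "t = \<mu> * (1 - s)" using \<mu> by (simp add: s_def field_simps)
  define X Y Z where "X = ip u x" and "Y = ip v x" and "Z = ip w x"
  have c: "ip v u = 0" "ip w u = 1" "ip w v = q"
    using null uw vw by (simp_all add: ip_commute)
  have vw': "ip v w' = q" using null vw c by (simp add: w' ip_bilinear)
  have w'x: "ip w' x = Z + \<mu> * (Y - q * X)"
    by (simp add: w' ip_bilinear X_def Y_def Z_def)
  have w'u: "ip w' u = 1" and w'w: "ip w' w = 0" and w'v: "ip w' v = q"
    using null c uw vw by (simp_all add: w' ip_bilinear)
  define y where "y = x + t *\<^sub>R wedge u v x"
  have y: "y = x + (- t * Y) *\<^sub>R u + (t * X) *\<^sub>R v"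
    by (simp add: y_def wedge_def X_def Y_def algebra_simps)
  have vy: "ip v y = Y" "ip w' y = Z + \<mu> * (Y - q * X) - t * Y + t * X * q"
    using null c by (simp_all add: y ip_bilinear w'x w'u w'v Y_def)
  define z where "z = boost u w s x"
  have z: "z = x + ((inverse s - 1) * Z) *\<^sub>R u + ((s - 1) * X) *\<^sub>R w"
    by (simp add: z_def boost_def uw X_def Z_def)
  have wz: "ip w z = inverse s * Z" "ip w' z = Z + \<mu> * (Y - q * X) + (inverse s - 1) * Z"
    using null c by (simp_all add: z ip_bilinear w'x w'u w'w Z_def algebra_simps)
  define d e k where "d = (inverse s - 1) * (Z + \<mu> * (Y - q * X) - t * Y + t * X * q) / q"
    and "e = (s - 1) * Y / q" and "k = t / (\<mu>^2 * q)"
  have L: "?L = y + d *\<^sub>R v + e *\<^sub>R w'"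
    by (simp add: y_def[symmetric] s_def[symmetric] boost_def vw' vy d_def e_def)
  define f g where "f = inverse s * Z" and "g = Z + \<mu> * (Y - q * X) + (inverse s - 1) * Z"
  have "wedge w ((1 / (\<mu>^2 * q)) *\<^sub>R w') z = (1 / (\<mu>^2 * q)) *\<^sub>R (f *\<^sub>R w' - g *\<^sub>R w)"
    unfolding wedge_scale_right unfolding wedge_def wz f_def g_def ..
  then have R: "?R = z + k *\<^sub>R (f *\<^sub>R w' - g *\<^sub>R w)"
    by (simp add: z_def[symmetric] s_def[symmetric] k_def)
  have L': "?L = x + (- t * Y - e * \<mu> * q) *\<^sub>R u + (t * X + d + e * \<mu>) *\<^sub>R v + e *\<^sub>R w"
    unfolding L unfolding y w' by (simp add: algebra_simps)
  have R': "?R = x + ((inverse s - 1) * Z - k * f * \<mu> * q) *\<^sub>R u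
     + (k * f * \<mu>) *\<^sub>R v + ((s - 1) * X + k * (f - g)) *\<^sub>R w"
    unfolding R unfolding z w' by (simp add: algebra_simps)
  have "- t * Y - e * \<mu> * q = (inverse s - 1) * Z - k * f * \<mu> * q"
    unfolding k_def e_def f_def t using s0 \<mu>(1) vw(2) by (simp add: field_simps power2_eq_square)
  moreover have "t * X + d + e * \<mu> = k * f * \<mu>"
    unfolding k_def d_def e_def f_def t using s0 \<mu>(1) vw(2) by (simp add: field_simps power2_eq_square)
  moreover have "e = (s - 1) * X + k * (f - g)"
    unfolding k_def e_def f_def g_def t using s0 \<mu>(1) vw(2) by (simp add: field_simps power2_eq_square)
  ultimately show ?thesis unfolding L' R' by simp
qed

text \<open>The fourth vertex of a Bianchi quadrilateral lies in the span of the other three, so both sides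
  differ from the identity only by vectors in that 3-space. The vector \<open>w3\<close> is
  \<open>a \<Gamma>_u^w1(1 - b/a) w2\<close>; exchanging \<open>(a, w1)\<close> with \<open>(b, w2)\<close> changes its sign only, which makes the
  claim symmetric.\<close>

lemma square_identity:
  assumes null: "ip u u = 0" "ip w1 w1 = 0" "ip w2 w2 = 0"
    and norm: "ip u w1 = 1" "ip u w2 = 1" and p: "ip w1 w2 = p" "p \<noteq> 0"
    and ab: "a \<noteq> 0" "b \<noteq> 0" "a \<noteq> b" and t: "t \<noteq> a" "t \<noteq> b"
    and w3: "w3 = a *\<^sub>R w2 - b *\<^sub>R w1 + (a * b * p / (a - b)) *\<^sub>R u"
  shows "boost w1 w3 (1 - t / b) (boost u w1 (1 - t / a) x) =
         boost w2 w3 (1 - t / a) (boost u w2 (1 - t / b) x)"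
    (is "?L = ?R")
proof -
  have c: "ip w1 u = 1" "ip w2 u = 1" "ip w2 w1 = p"
    using norm p by (simp_all add: ip_commute)
  define X Y Z where "X = ip u x" and "Y = ip w1 x" and "Z = ip w2 x"
  define s r where "s = 1 - t / a" and "r = 1 - t / b"
  have s: "s - 1 = - t / a" "inverse s - 1 = t / (a - t)" and r: "r - 1 = - t / b" "inverse r - 1 = t / (b - t)"
    using t ab by (simp_all add: s_def r_def field_simps)
  have w1w3: "ip w1 w3 = a^2 * p / (a - b)" and w2w3: "ip w2 w3 = b^2 * p / (a - b)"
    using null p c norm ab by (simp_all add: w3 ip_bilinear field_simps power2_eq_square)
  have w3u: "ip w3 u = a - b"
    using null c by (simp add: w3 ip_bilinear)
  have w3x: "ip w3 x = a * Z - b * Y + a * b * p / (a - b) * X"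
    by (simp add: w3 ip_bilinear X_def Y_def Z_def)
  define y z where "y = boost u w1 s x" and "z = boost u w2 r x"
  have y: "y = x + (t / (a - t) * Y) *\<^sub>R u + (- t / a * X) *\<^sub>R w1"
    by (simp add: y_def boost_def s norm X_def Y_def)
  have z: "z = x + (t / (b - t) * Z) *\<^sub>R u + (- t / b * X) *\<^sub>R w2"
    by (simp add: z_def boost_def r norm X_def Z_def)
  define V1 V2 where "V1 = a * Z - b * Y + a * b * p / (a - b) * X + t / (a - t) * Y * (a - b) - t / a * X * (a^2 * p / (a - b))"
    and "V2 = a * Z - b * Y + a * b * p / (a - b) * X + t / (b - t) * Z * (a - b) - t / b * X * (b^2 * p / (a - b))"
  have V1: "ip w3 y = V1" 
    unfolding y V1_def using w1w3 by (simp add: ip_bilinear w3x w3u ip_commute[of w3 w1])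
  have V2: "ip w3 z = V2"
    unfolding z V2_def using w2w3 by (simp add: ip_bilinear w3x w3u ip_commute[of w3 w2])
  have w1y: "ip w1 y = Y + t / (a - t) * Y" and w2z: "ip w2 z = Z + t / (b - t) * Z"
    unfolding y z using null c by (simp_all add: ip_bilinear X_def Y_def Z_def)
  define k where "k = p / (a - b)"
  have k0: "k \<noteq> 0" and pk: "p = k * (a - b)" using p ab by (simp_all add: k_def)
  have w13: "ip w1 w3 = a^2 * k" and w23: "ip w2 w3 = b^2 * k"
    by (simp_all add: w1w3 w2w3 k_def)
  have w3k: "w3 = a *\<^sub>R w2 - b *\<^sub>R w1 + (a * b * k) *\<^sub>R u" by (simp add: w3 k_def)
  define B1 C1 where "B1 = t / (b - t) * V1 / (a^2 * k)" and "C1 = - t / b * (Y + t / (a - t) * Y) / (a^2 * k)"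
  define B2 C2 where "B2 = t / (a - t) * V2 / (b^2 * k)" and "C2 = - t / a * (Z + t / (b - t) * Z) / (b^2 * k)"
  have "?L = y + B1 *\<^sub>R w1 + C1 *\<^sub>R w3"
    by (simp add: s_def[symmetric] r_def[symmetric] y_def[symmetric] boost_def[of w1 w3] w13 w1y V1 r B1_def C1_def)
  then have L: "?L = x + (t / (a - t) * Y + C1 * a * b * k) *\<^sub>R u + (- t / a * X + B1 - b * C1) *\<^sub>R w1 + (a * C1) *\<^sub>R w2"
    unfolding y w3k by (simp add: algebra_simps)
  have "?R = z + B2 *\<^sub>R w2 + C2 *\<^sub>R w3"
    by (simp add: s_def[symmetric] r_def[symmetric] z_def[symmetric] boost_def[of w2 w3] w23 w2z V2 s B2_def C2_def)
  then have R: "?R = x + (t / (b - t) * Z + C2 * a * b * k) *\<^sub>R u + (- b * C2) *\<^sub>R w1 + (- t / b * X + B2 + a * C2) *\<^sub>R w2"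
    unfolding z w3k by (simp add: algebra_simps)
  have nz: "a - t \<noteq> 0" "b - t \<noteq> 0" "a - b \<noteq> 0" using t ab by auto
  have e: "a * b * p / (a - b) = a * b * k" "a^2 * p / (a - b) = a^2 * k" "b^2 * p / (a - b) = b^2 * k"
    by (simp_all add: k_def)
  have "t / (a - t) * Y + C1 * a * b * k = t / (b - t) * Z + C2 * a * b * k"
    unfolding C1_def C2_def using nz ab k0 by (simp add: field_simps power2_eq_square)
  moreover have "- t / a * X + B1 - b * C1 = - b * C2"
    unfolding B1_def C1_def C2_def V1_def e using nz ab k0 
    by (simp add: divide_simps power2_eq_square) (simp add: algebra_simps)
  moreover have "a * C1 = - t / b * X + B2 + a * C2"
    unfolding B2_def C1_def C2_def V2_def e using nz ab k0 
    by (simp add: divide_simps power2_eq_square) (simp add: algebra_simps)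
  ultimately show ?thesis unfolding L R by simp
qed

section \<open>Null lines and null planes\<close>

lemma orthogonal_lines_span: "orthogonal_lines (span {u}) (span {w}) \<longleftrightarrow> ip u w = 0"
  unfolding orthogonal_lines_def
proof
  assume "\<forall>v\<in>span {u}. \<forall>y\<in>span {w}. ip v y = 0"
  then show "ip u w = 0" by (simp add: span_base)
next
  assume uw: "ip u w = 0"
  show "\<forall>v\<in>span {u}. \<forall>y\<in>span {w}. ip v y = 0"
  proof (intro ballI)
    fix v y assume "v \<in> span {u}" "y \<in> span {w}"
    then obtain a b where "v = a *\<^sub>R u" "y = b *\<^sub>R w"
      unfolding mem_line by (elim exE)
    with uw show "ip v y = 0" by (simp add: ip_bilinear)
  qed
qed

lemma span_scaled: "r \<noteq> 0 \<Longrightarrow> span {r *\<^sub>R w} = span {w::r42}"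
  using span_image_scale[of "{w}" "\<lambda>_. r"] by simp

lemma null_line_normalized:
  assumes "null_line g" "\<not> orthogonal_lines (span {u}) g"
  obtains w where "g = span {w}" "ip w w = 0" "ip u w = 1"
proof -
  obtain w where w: "ip w w = 0" "g = span {w}"
    using assms(1) unfolding null_line_def by blast
  with assms(2) have uw: "ip u w \<noteq> 0" by (simp add: orthogonal_lines_span)
  show thesis
  proof
    show "g = span {inverse (ip u w) *\<^sub>R w}" using uw w by (simp add: span_scaled)
  qed (use uw w in \<open>simp_all add: ip_bilinear\<close>)
qed

text \<open>For null lines \<open>f\<close>, \<open>g\<close> this says that \<open>f \<oplus> g\<close> is a null plane and that \<open>\<tau>\<close> is a nonzero element
  of \<open>f \<and> g\<close>. Non-vanishing of \<open>\<tau>\<close> is what propagates along edges; it encodes the linear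
  independence of the two lines.\<close>

definition spans_null_plane :: "r42 set \<Rightarrow> r42 set \<Rightarrow> (r42 \<Rightarrow> r42) \<Rightarrow> bool" where
  "spans_null_plane f g \<tau> \<longleftrightarrow>
     (\<exists>u v. f = span {u} \<and> g = span {v} \<and> \<tau> = wedge u v \<and>
            ip u u = 0 \<and> ip u v = 0 \<and> ip v v = 0 \<and> wedge u v \<noteq> (\<lambda>_. 0))"

lemma wedge_dependent:
  assumes "wedge u v \<noteq> (\<lambda>_. 0)"
  shows "u \<notin> span {v}" "v \<noteq> 0" "u \<noteq> 0"
proof -
  show "u \<notin> span {v}"
  proof
    assume "u \<in> span {v}"
    then obtain r where "u = r *\<^sub>R v" unfolding mem_line by (elim exE)
    then have "wedge u v = (\<lambda>_. 0)" by (intro ext) (simp add: wedge_def ip_bilinear)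
    with assms show False by contradiction
  qed
  then show "u \<noteq> 0" using span_zero by blast
  show "v \<noteq> 0"
  proof
    assume "v = 0"
    then have "wedge u v = (\<lambda>_. 0)" by (intro ext) (simp add: wedge_def ip_bilinear)
    with assms show False by contradiction
  qed
qed

lemma spans_null_planeD:
  assumes "spans_null_plane f g \<tau>"
  shows "null_line f" "null_line g" "null_plane (f \<oplus>\<^sub>s g)" "\<tau> \<in> wedge_sub f g" "linear \<tau>"
    "op_exp (\<lambda>z. t *\<^sub>R \<tau> z) = (\<lambda>z. z + t *\<^sub>R \<tau> z)" "\<tau> (\<tau> z) = 0"
proof -
  obtain u v where uv: "f = span {u}" "g = span {v}" "\<tau> = wedge u v"
    and null: "ip u u = 0" "ip u v = 0" "ip v v = 0" and nz: "wedge u v \<noteq> (\<lambda>_. 0)"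
    using assms unfolding spans_null_plane_def by blast
  note indep = wedge_dependent[OF nz]
  show "null_line f" "null_line g"
    unfolding null_line_def using uv null indep by blast+
  show "\<tau> \<in> wedge_sub f g"
    unfolding wedge_sub_def uv using span_base by blast
  show "linear \<tau>" "op_exp (\<lambda>z. t *\<^sub>R \<tau> z) = (\<lambda>z. z + t *\<^sub>R \<tau> z)" "\<tau> (\<tau> z) = 0"
    unfolding uv(3) using linear_wedge op_exp_wedge[OF null] wedge_square[OF null] by blast+
  have "independent {u, v}"
    using indep by (intro independent_insertI) (simp_all add: independent_empty)
  moreover have "u \<noteq> v" using indep span_base by blast
  ultimately have "dim (f \<oplus>\<^sub>s g) = 2"
    unfolding uv plus_sub_lines dim_span by (simp add: dim_eq_card_independent)
  moreover have "ip x y = 0" if x: "x \<in> f \<oplus>\<^sub>s g" and y: "y \<in> f \<oplus>\<^sub>s g" for x y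
  proof -
    obtain a b where "x = a *\<^sub>R u + b *\<^sub>R v"
      using x unfolding uv mem_plus_sub_lines by (elim exE)
    moreover obtain c d where "y = c *\<^sub>R u + d *\<^sub>R v"
      using y unfolding uv mem_plus_sub_lines by (elim exE)
    ultimately show ?thesis
      using null ip_commute[of v u] by (simp add: ip_bilinear)
  qed
  moreover have "subspace (f \<oplus>\<^sub>s g)"
    unfolding uv plus_sub_lines by (rule subspace_span)
  ultimately show "null_plane (f \<oplus>\<^sub>s g)"
    unfolding null_plane_def by blast
qed

lemma spans_null_planeI:
  assumes "null_plane (f \<oplus>\<^sub>s g)" "null_line f" "null_line g" "\<tau> \<in> wedge_sub f g" "\<tau> \<noteq> (\<lambda>_. 0)"
  shows "spans_null_plane f g \<tau>"
proof -
  obtain u v where uv: "u \<in> f" "v \<in> g" "\<tau> = wedge u v"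
    using assms(4) unfolding wedge_sub_def by blast
  with assms(5) have nz: "wedge u v \<noteq> (\<lambda>_. 0)" by simp
  have *: "h = span {w}" if "null_line h" "w \<in> h" "w \<noteq> 0" for h w
  proof -
    obtain x where x: "h = span {x}" using \<open>null_line h\<close> unfolding null_line_def by (elim exE conjE)
    obtain r where r: "w = r *\<^sub>R x" using \<open>w \<in> h\<close> unfolding x mem_line by (elim exE)
    then have "r \<noteq> 0" using \<open>w \<noteq> 0\<close> by auto
    then show ?thesis unfolding x r by (simp add: span_scaled)
  qed
  have f: "f = span {u}" and g: "g = span {v}"
    using * assms(2,3) uv wedge_dependent[OF nz] by blast+
  have "u \<in> f \<oplus>\<^sub>s g" "v \<in> f \<oplus>\<^sub>s g"
    unfolding f g plus_sub_lines by (simp_all add: span_base)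
  then have "ip u u = 0" "ip u v = 0" "ip v v = 0"
    using assms(1) unfolding null_plane_def by blast+
  with f g uv(3) nz show ?thesis unfolding spans_null_plane_def by blast
qed

lemma op_exp_inverse:
  assumes "spans_null_plane f g \<tau>"
  shows "op_exp (\<lambda>z. t *\<^sub>R \<tau> z) (op_exp (\<lambda>z. - t *\<^sub>R \<tau> z) x) = x"
    "op_exp (\<lambda>z. - t *\<^sub>R \<tau> z) (op_exp (\<lambda>z. t *\<^sub>R \<tau> z) x) = x"
  unfolding spans_null_planeD(6)[OF assms]
  by (simp_all add: linear_diff[OF spans_null_planeD(5)[OF assms]] linear_add[OF spans_null_planeD(5)[OF assms]]
      linear_cmul[OF spans_null_planeD(5)[OF assms]] spans_null_planeD(7)[OF assms])

lemma Gam_inverse: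
  assumes "null_line f" "null_line g" "\<not> orthogonal_lines f g" "s \<noteq> 0"
  shows "Gam f g s (Gam f g (inverse s) x) = x" "Gam f g (inverse s) (Gam f g s x) = x"
    "inv (Gam f g s) = Gam f g (inverse s)"
proof -
  obtain u where u: "ip u u = 0" "f = span {u}" using assms(1) unfolding null_line_def by blast
  obtain w where w: "g = span {w}" "ip w w = 0" "ip u w = 1"
    using null_line_normalized[OF assms(2)] assms(3) u(2) by metis
  show 1: "Gam f g s (Gam f g (inverse s) x) = x" "Gam f g (inverse s) (Gam f g s x) = x" for x
    using u w assms(4) by (simp_all add: Gam_span boost_boost boost_one)
  show "inv (Gam f g s) = Gam f g (inverse s)"
    by (rule inv_unique_comp) (simp_all add: fun_eq_iff 1)
qed

text \<open>The plane can be recovered from \<open>\<tau>\<close>: the inner product of signature (4,2) is nondegenerate, so the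
  linear forms \<open>(u, \<cdot>)\<close> and \<open>(v, \<cdot>)\<close> take arbitrary pairs of values.\<close>

lemma spans_null_plane_range:
  assumes "spans_null_plane f g \<tau>"
  shows "range \<tau> = f \<oplus>\<^sub>s g"
proof -
  obtain u v where uv: "f = span {u}" "g = span {v}" "\<tau> = wedge u v"
    and null: "ip u u = 0" "ip u v = 0" "ip v v = 0" and nz: "wedge u v \<noteq> (\<lambda>_. 0)"
    using assms unfolding spans_null_plane_def by blast
  note indep = wedge_dependent[OF nz]
  define J :: "r42 \<Rightarrow> r42" where "J x = (fst x, - snd x)" for x
  have ipJ: "ip x (J y) = x \<bullet> y" for x y by (simp add: ip_def J_def inner_prod_def)
  have dual: "\<exists>x. ip a x = 0 \<and> ip b x = 1" if "b \<notin> span {a}" "a \<noteq> 0" for a b :: r42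
  proof -
    define y where "y = b - (a \<bullet> b / (a \<bullet> a)) *\<^sub>R a"
    have aa: "a \<bullet> a \<noteq> 0" using that by simp
    have "y \<noteq> 0"
    proof
      assume "y = 0"
      then have "b = (a \<bullet> b / (a \<bullet> a)) *\<^sub>R a" by (simp add: y_def)
      then have "b \<in> span {a}" unfolding mem_line by (rule exI)
      with that(1) show False by contradiction
    qed
    then have yy: "y \<bullet> y \<noteq> 0" by simp
    have ay: "a \<bullet> y = 0" using aa by (simp add: y_def inner_diff_right)
    moreover have "b = y + (a \<bullet> b / (a \<bullet> a)) *\<^sub>R a" by (simp add: y_def)
    ultimately have "b \<bullet> y = y \<bullet> y" by (metis inner_add_left inner_scaleR_left mult_zero_right add_0_right)
    with ay yy show ?thesis
      by (intro exI[of _ "J ((1 / (y \<bullet> y)) *\<^sub>R y)"]) (simp add: ipJ)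
  qed
  have "v \<notin> span {u}"
  proof
    assume "v \<in> span {u}"
    then obtain r where "v = r *\<^sub>R u" unfolding mem_line by (elim exE)
    then have "wedge u v = (\<lambda>_. 0)" by (intro ext) (simp add: wedge_def ip_bilinear)
    with nz show False by contradiction
  qed
  then obtain x where x: "ip u x = 0" "ip v x = 1" using dual[of v u] indep by metis
  obtain y where y: "ip v y = 0" "ip u y = 1" using dual[of u v] indep by metis
  show ?thesis
  proof (intro set_eqI iffI)
    fix z assume "z \<in> range \<tau>"
    then obtain w where "z = wedge u v w" unfolding uv by (elim rangeE)
    then have "z = (- ip v w) *\<^sub>R u + ip u w *\<^sub>R v" by (simp add: wedge_def)
    then show "z \<in> f \<oplus>\<^sub>s g" unfolding uv mem_plus_sub_lines by (intro exI)
  next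
    fix z assume "z \<in> f \<oplus>\<^sub>s g"
    then obtain a b where z: "z = a *\<^sub>R u + b *\<^sub>R v" unfolding uv mem_plus_sub_lines by (elim exE)
    have "\<tau> (b *\<^sub>R y - a *\<^sub>R x) = z"
      unfolding uv z using x y by (simp add: wedge_def ip_bilinear)
    then show "z \<in> range \<tau>" by (metis rangeI)
  qed
qed

lemma null_line_generator:
  assumes "null_line f" "f = span {v}"
  shows "ip v v = 0"
proof -
  obtain w where w: "ip w w = 0" "f = span {w}" using assms(1) unfolding null_line_def by blast
  have "v \<in> f" unfolding assms(2) by (simp add: span_base)
  then obtain r where "v = r *\<^sub>R w" unfolding w mem_line by (elim exE)
  with w show ?thesis by (simp add: ip_bilinear)
qed

section \<open>Edges and squares of the lattice\<close>

text \<open>The first conjunct is the Lie-Darboux relation on an edge. The second is the gauge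
  relation between the discrete connections, whose factors are singular at \<open>t = \<mu>\<close>; the first is what
  remains of it there. It is kept as a separate conjunct because it is the condition under which \<open>\<tau>\<close>
  can be transported along the edge.\<close>

definition isotropic_edge ::
  "r42 set \<Rightarrow> r42 set \<Rightarrow> (r42 \<Rightarrow> r42) \<Rightarrow> r42 set \<Rightarrow> r42 set \<Rightarrow> (r42 \<Rightarrow> r42) \<Rightarrow> real \<Rightarrow> bool" where
  "isotropic_edge fp fm \<tau> gp gm \<sigma> \<mu> \<longleftrightarrow>
     gm = op_exp (\<lambda>z. \<mu> *\<^sub>R \<tau> z) ` gp \<and>
     (\<forall>t. t \<noteq> \<mu> \<longrightarrow>
        Gam fm gm (1 - t / \<mu>) =
        op_exp (\<lambda>z. t *\<^sub>R \<sigma> z) \<circ> Gam fp gp (1 - t / \<mu>) \<circ> op_exp (\<lambda>z. - t *\<^sub>R \<tau> z))"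

text \<open>With generators \<open>u\<close>, \<open>v\<close>, \<open>w\<close>, \<open>w'\<close> of the four lines, normalized to \<open>(u, w) = 1\<close>, this is
  \<open>edge_identity\<close>. The number
  \<open>(v, w)\<close> is nonzero since \<open>(v, w) = (v, w')\<close> and \<open>f\<^sub>i\<^sup>-\<close>, \<open>f\<^sub>j\<^sup>-\<close> are not orthogonal.\<close>

lemma isotropic_edge_exists:
  assumes i: "spans_null_plane fp fm \<tau>" and gp: "null_line gp" and gm: "gm = op_exp (\<lambda>z. \<mu> *\<^sub>R \<tau> z) ` gp"
    and nonorth: "\<not> orthogonal_lines fp gp" "\<not> orthogonal_lines fm gm" and \<mu>: "\<mu> \<noteq> 0"
  obtains \<sigma> where "spans_null_plane gp gm \<sigma>" "isotropic_edge fp fm \<tau> gp gm \<sigma> \<mu>"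
proof -
  obtain u v where uv: "fp = span {u}" "fm = span {v}" "\<tau> = wedge u v"
    and null: "ip u u = 0" "ip u v = 0" "ip v v = 0" and nz: "wedge u v \<noteq> (\<lambda>_. 0)"
    using i unfolding spans_null_plane_def by blast
  obtain w where w: "gp = span {w}" "ip w w = 0" "ip u w = 1"
    using null_line_normalized[OF gp] nonorth(1) uv(1) by metis
  define q where "q = ip v w"
  define w' where "w' = w + \<mu> *\<^sub>R (v - q *\<^sub>R u)"
  have c: "ip v u = 0" "ip w u = 1" "ip w v = q"
    using null w by (simp_all add: ip_commute q_def)
  have exp\<tau>: "op_exp (\<lambda>z. t *\<^sub>R \<tau> z) = (\<lambda>z. z + t *\<^sub>R wedge u v z)" for t
    unfolding uv(3) by (rule op_exp_wedge[OF null])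
  have "linear (\<lambda>z. z + \<mu> *\<^sub>R wedge u v z)"
    by (intro linear_compose_add linear_ident linear_compose_scale_right linear_wedge)
  then have "gm = span {w + \<mu> *\<^sub>R wedge u v w}"
    unfolding gm exp\<tau> w(1) by (subst linear_span_image[symmetric]) simp_all
  moreover have "w + \<mu> *\<^sub>R wedge u v w = w'"
    using w by (simp add: w'_def wedge_def q_def)
  ultimately have gm': "gm = span {w'}" by simp
  have vw': "ip v w' = q" using null c by (simp add: w'_def ip_bilinear q_def)
  have q: "q \<noteq> 0" using nonorth(2) unfolding uv(2) gm' orthogonal_lines_span vw' .
  have w'w': "ip w' w' = 0" and ww': "ip w w' = 0"
    using null c w q_def by (simp_all add: w'_def ip_bilinear algebra_simps)
  define r where "r = 1 / (\<mu>^2 * q)"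
  have r: "r \<noteq> 0" using q \<mu> by (simp add: r_def)
  let ?\<sigma> = "wedge w (r *\<^sub>R w')"
  have null': "ip w w = 0" "ip w (r *\<^sub>R w') = 0" "ip (r *\<^sub>R w') (r *\<^sub>R w') = 0"
    using w'w' ww' w by (simp_all add: ip_bilinear)
  have nz': "?\<sigma> \<noteq> (\<lambda>_. 0)"
  proof
    assume "?\<sigma> = (\<lambda>_. 0)"
    then have "r *\<^sub>R wedge w w' u = 0" unfolding wedge_scale_right by (rule fun_cong)
    then have "wedge w w' u = 0" using r by simp
    moreover have "ip w' u = 1" using c null by (simp add: w'_def ip_bilinear)
    ultimately have "w' - w = 0" using c by (simp add: wedge_def)
    then have "v - q *\<^sub>R u = 0" using \<mu> by (simp add: w'_def)
    then have "v = q *\<^sub>R u" by simp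
    then have "wedge u v = (\<lambda>_. 0)" by (intro ext) (simp add: wedge_def ip_bilinear)
    with nz show False by contradiction
  qed
  have \<sigma>: "spans_null_plane gp gm ?\<sigma>"
    unfolding spans_null_plane_def
    by (intro exI[of _ w] exI[of _ "r *\<^sub>R w'"] conjI w(1) null' nz' refl) (simp add: gm' span_scaled r)
  show thesis
  proof (rule that[OF \<sigma>], unfold isotropic_edge_def, intro conjI allI impI)
    fix t assume t: "t \<noteq> \<mu>"
    define s where "s = 1 - t / \<mu>"
    have s: "s \<noteq> 0" using t \<mu> by (simp add: s_def)
    have G: "Gam fm gm s = boost v w' s" "Gam fp gp s = boost u w s"
      unfolding uv gm' w(1) by (intro Gam_span; use null w w'w' vw' q s in simp)+
    have "Gam fm gm s x = op_exp (\<lambda>z. t *\<^sub>R ?\<sigma> z) (Gam fp gp s (op_exp (\<lambda>z. - t *\<^sub>R \<tau> z) x))" for x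
    proof -
      define y where "y = op_exp (\<lambda>z. - t *\<^sub>R \<tau> z) x"
      have "x = y + t *\<^sub>R wedge u v y"
        using op_exp_inverse(1)[OF i, of t x, folded y_def] unfolding exp\<tau> by (rule sym)
      then have "Gam fm gm s x = boost u w s y + t *\<^sub>R ?\<sigma> (boost u w s y)"
        using edge_identity[OF null w(2,3) q_def[symmetric] q \<mu> t w'_def, of y]
        unfolding G r_def unfolding s_def by (simp only:)
      also have "\<dots> = op_exp (\<lambda>z. t *\<^sub>R ?\<sigma> z) (boost u w s y)"
        unfolding op_exp_wedge[OF null'] ..
      finally show ?thesis unfolding G y_def .
    qed
    then show "Gam fm gm (1 - t / \<mu>) =
        op_exp (\<lambda>z. t *\<^sub>R ?\<sigma> z) \<circ> Gam fp gp (1 - t / \<mu>) \<circ> op_exp (\<lambda>z. - t *\<^sub>R \<tau> z)"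
      unfolding s_def by (simp add: fun_eq_iff)
  qed (rule gm)
qed

text \<open>Non-orthogonality of \<open>f\<^sub>j\<close> and \<open>f\<^sub>k\<close> forces that of \<open>f\<^sub>j\<close> and \<open>f\<^sub>\<ell>\<close>, and this makes the 3-space spanned by \<open>f\<^sub>i\<close>, \<open>f\<^sub>j\<close>, \<open>f\<^sub>\<ell>\<close>
  nondegenerate, with \<open>f\<^sub>k\<close> inside it. The last conclusion transports orthogonality to a conserved
  quantity across the square.\<close>

lemma bianchi_square:
  assumes lines: "null_line fi" "null_line fj" "null_line fl"
    and fk: "fk = Gam fi fj (1 - b / a) ` fl"
    and ab: "a \<noteq> 0" "b \<noteq> 0" "a \<noteq> b"
    and nonorth: "\<not> orthogonal_lines fi fj" "\<not> orthogonal_lines fi fl" "\<not> orthogonal_lines fj fk"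
  shows "null_line fk" "fk = Gam fi fl (1 - a / b) ` fj"
    "\<And>t. t \<noteq> a \<Longrightarrow> t \<noteq> b \<Longrightarrow> Gam fj fk (1 - t / b) \<circ> Gam fi fj (1 - t / a) =
       Gam fl fk (1 - t / a) \<circ> Gam fi fl (1 - t / b)"
    "\<And>c. c \<in> perp fi \<Longrightarrow> c \<in> perp fj \<Longrightarrow> c \<in> perp fl \<Longrightarrow> c \<in> perp fk"
proof -
  obtain u where u: "ip u u = 0" "fi = span {u}" using lines(1) unfolding null_line_def by blast
  obtain w1 where w1: "fj = span {w1}" "ip w1 w1 = 0" "ip u w1 = 1"
    using null_line_normalized[OF lines(2)] nonorth(1) u(2) by metis
  obtain w2 where w2: "fl = span {w2}" "ip w2 w2 = 0" "ip u w2 = 1"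
    using null_line_normalized[OF lines(3)] nonorth(2) u(2) by metis
  define p where "p = ip w1 w2"
  define w3 where "w3 = a *\<^sub>R w2 - b *\<^sub>R w1 + (a * b * p / (a - b)) *\<^sub>R u"
  have c: "ip w1 u = 1" "ip w2 u = 1" "ip w2 w1 = p"
    using w1 w2 by (simp_all add: ip_commute p_def)
  have s: "1 - b / a \<noteq> 0" "1 - a / b \<noteq> 0" using ab by simp_all
  have G: "Gam fi fj r = boost u w1 r" "Gam fi fl r = boost u w2 r" if "r \<noteq> 0" for r
    unfolding u w1(1) w2(1) by (intro Gam_span; use u w1 w2 that in simp)+
  have span_img: "boost x y r ` span {z} = span {boost x y r z}" for x y z r
    by (subst linear_span_image[OF linear_boost, symmetric]) simp
  have ab': "a - b \<noteq> 0" "b - a \<noteq> 0" using ab by simp_all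
  have "boost u w1 (1 - b / a) w2 = w2 + (b / (a - b) * p) *\<^sub>R u + (- (b / a)) *\<^sub>R w1"
    using ab ab' w1 w2 by (simp add: boost_def p_def field_simps)
  also have "\<dots> = (1 / a) *\<^sub>R w3"
    using ab by (simp add: w3_def algebra_simps)
  finally have fk3: "fk = span {w3}"
    unfolding fk G(1)[OF s(1)] w2(1) span_img using ab by (simp add: span_scaled)
  have "boost u w2 (1 - a / b) w1 = w1 + (a / (b - a) * p) *\<^sub>R u + (- (a / b)) *\<^sub>R w2"
    using ab ab' w1 w2 c by (simp add: boost_def p_def field_simps)
  also have "\<dots> = (- (1 / b)) *\<^sub>R w3"
  proof -
    have "a / (b - a) * p = - (1 / b) * (a * b * p / (a - b))"
      using ab ab' by (simp add: field_simps)
    then show ?thesis using ab by (simp add: w3_def algebra_simps)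
  qed
  finally show "fk = Gam fi fl (1 - a / b) ` fj"
    unfolding fk3 G(2)[OF s(2)] w1(1) span_img using ab by (simp add: span_scaled del: scaleR_minus_left)
  define k where "k = p / (a - b)"
  have pk: "p = k * (a - b)" using ab' by (simp add: k_def)
  have w3k: "w3 = a *\<^sub>R w2 - b *\<^sub>R w1 + (a * b * k) *\<^sub>R u" by (simp add: w3_def k_def)
  have w13: "ip w1 w3 = a^2 * k" and w23: "ip w2 w3 = b^2 * k" and w33: "ip w3 w3 = 0"
    using u(1) w1(2,3) w2(2,3) c unfolding w3k
    by (simp_all add: ip_bilinear p_def[symmetric]) (simp_all add: pk algebra_simps power2_eq_square)
  have p: "p \<noteq> 0"
  proof
    assume "p = 0"
    then have "ip w1 w3 = 0" unfolding w13 k_def by simp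
    with nonorth(3) show False unfolding w1(1) fk3 orthogonal_lines_span by contradiction
  qed
  have w3: "w3 \<noteq> 0"
  proof
    assume "w3 = 0"
    then have "ip w1 w3 = 0" by (simp add: ip_bilinear)
    with w13 p ab ab' show False by (simp add: k_def)
  qed
  show "null_line fk" unfolding null_line_def using w3 w33 fk3 by blast
  show "Gam fj fk (1 - t / b) \<circ> Gam fi fj (1 - t / a) = Gam fl fk (1 - t / a) \<circ> Gam fi fl (1 - t / b)"
    if t: "t \<noteq> a" "t \<noteq> b" for t
  proof -
    have st: "1 - t / a \<noteq> 0" "1 - t / b \<noteq> 0" using t ab by simp_all
    have H: "Gam fj fk r = boost w1 w3 r" "Gam fl fk r = boost w2 w3 r" if "r \<noteq> 0" for r
      unfolding fk3 w1(1) w2(1) by (intro Gam_span; use w1 w2 w33 w13 w23 p ab ab' that in \<open>simp add: k_def\<close>)+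
    show ?thesis
      unfolding G[OF st(1)] G[OF st(2)] H[OF st(1)] H[OF st(2)]
      using square_identity[OF u(1) w1(2) w2(2) w1(3) w2(3) p_def[symmetric] p ab t w3_def]
      by (simp add: fun_eq_iff)
  qed
  show "c \<in> perp fk" if "c \<in> perp fi" "c \<in> perp fj" "c \<in> perp fl" for c
  proof -
    have "ip c u = 0" "ip c w1 = 0" "ip c w2 = 0"
      using that unfolding perp_def u(2) w1(1) w2(1) by (simp_all add: span_base)
    then have "ip c w3 = 0" by (simp add: w3_def ip_bilinear)
    then show ?thesis
      unfolding perp_def fk3 mem_Collect_eq
    proof (intro ballI)
      fix y assume "y \<in> span {w3}"
      then obtain r where "y = r *\<^sub>R w3" unfolding mem_line by (elim exE)
      with \<open>ip c w3 = 0\<close> show "ip c y = 0" by (simp add: ip_bilinear)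
    qed
  qed
qed

text \<open>At a single \<open>t\<close> the gauge relation determines \<open>exp(t\<tau>\<^sub>j) = 1 + t\<tau>\<^sub>j\<close> from \<open>\<tau>\<^sub>i\<close>, because the other
  factors are invertible.\<close>

lemma isotropic_edge_unique:
  assumes j: "spans_null_plane gp gm \<sigma>" "spans_null_plane gp gm \<sigma>'"
    and i: "spans_null_plane fp fm \<tau>" and nonorth: "\<not> orthogonal_lines fp gp"
    and t: "t \<noteq> 0" "t \<noteq> \<mu>" "\<mu> \<noteq> 0"
    and eq: "op_exp (\<lambda>z. t *\<^sub>R \<sigma> z) \<circ> Gam fp gp (1 - t / \<mu>) \<circ> op_exp (\<lambda>z. - t *\<^sub>R \<tau> z) =
      op_exp (\<lambda>z. t *\<^sub>R \<sigma>' z) \<circ> Gam fp gp (1 - t / \<mu>) \<circ> op_exp (\<lambda>z. - t *\<^sub>R \<tau> z)"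
  shows "\<sigma> = \<sigma>'"
proof
  fix x
  define s where "s = 1 - t / \<mu>"
  have s: "s \<noteq> 0" using t by (simp add: s_def)
  note G = Gam_inverse(1)[OF spans_null_planeD(1)[OF i] spans_null_planeD(1)[OF j(1)] nonorth s]
  from fun_cong[OF eq[folded s_def], of "op_exp (\<lambda>z. t *\<^sub>R \<tau> z) (Gam fp gp (inverse s) x)"]
  have "op_exp (\<lambda>z. t *\<^sub>R \<sigma> z) x = op_exp (\<lambda>z. t *\<^sub>R \<sigma>' z) x"
    by (simp only: o_apply op_exp_inverse(2)[OF i] G)
  then show "\<sigma> x = \<sigma>' x"
    using t(1) unfolding spans_null_planeD(6)[OF j(1)] spans_null_planeD(6)[OF j(2)] by simp
qed

text \<open>Since \<open>f\<^sub>\<ell>\<^sup>- = exp(b\<tau>\<^sub>i) f\<^sub>\<ell>\<^sup>+\<close>, the gauge relation on the edge \<open>ij\<close> at \<open>t = b\<close> gives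
  \<open>f\<^sub>k\<^sup>- = \<Gamma>\<^sup>-(b)\<^sub>j\<^sub>i f\<^sub>\<ell>\<^sup>- = exp(b\<tau>\<^sub>j) \<Gamma>\<^sup>+(b)\<^sub>j\<^sub>i f\<^sub>\<ell>\<^sup>+ = exp(b\<tau>\<^sub>j) f\<^sub>k\<^sup>+\<close>, and symmetrically with \<open>j\<close> and \<open>\<ell>\<close> exchanged.
  Hence both edges ending in \<open>k\<close> produce a \<open>\<tau>\<^sub>k\<close>. The two agree because the connections commute around
  the square, for \<open>+\<close> and for \<open>-\<close>. It is enough to compare them at one \<open>t\<close>, so that each edge keeps
  its own full range of \<open>t\<close>, including the label of the other edge.\<close>

lemma isotropic_square:
  assumes i: "spans_null_plane fip fim \<tau>i" and j: "spans_null_plane fjp fjm \<tau>j" and l: "spans_null_plane flp flm \<tau>l"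
    and ij: "isotropic_edge fip fim \<tau>i fjp fjm \<tau>j a" and il: "isotropic_edge fip fim \<tau>i flp flm \<tau>l b"
    and kp: "fkp = Gam fip fjp (1 - b / a) ` flp" and km: "fkm = Gam fim fjm (1 - b / a) ` flm"
    and ab: "a \<noteq> 0" "b \<noteq> 0" "a \<noteq> b"
    and nop: "\<not> orthogonal_lines fip fjp" "\<not> orthogonal_lines fip flp" "\<not> orthogonal_lines fjp fkp" "\<not> orthogonal_lines flp fkp"
    and nom: "\<not> orthogonal_lines fim fjm" "\<not> orthogonal_lines fim flm" "\<not> orthogonal_lines fjm fkm" "\<not> orthogonal_lines flm fkm"
  obtains \<tau>k where "spans_null_plane fkp fkm \<tau>k"
    "isotropic_edge fjp fjm \<tau>j fkp fkm \<tau>k b" "isotropic_edge flp flm \<tau>l fkp fkm \<tau>k a"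
proof -
  note sqp = bianchi_square[OF spans_null_planeD(1)[OF i] spans_null_planeD(1)[OF j] spans_null_planeD(1)[OF l] kp ab nop(1-3)]
  note sqm = bianchi_square[OF spans_null_planeD(2)[OF i] spans_null_planeD(2)[OF j] spans_null_planeD(2)[OF l] km ab nom(1-3)]
  \<comment> \<open>Stated for an arbitrary edge leaving \<open>i\<close>, as it is used once for each of the two.\<close>
  have km_exp: "fk' = op_exp (\<lambda>z. b' *\<^sub>R \<tau> z) ` fk" 
    if e: "isotropic_edge fip fim \<tau>i gp gm \<tau> a'" and h: "hm = op_exp (\<lambda>z. b' *\<^sub>R \<tau>i z) ` hp"
      and k: "fk = Gam fip gp (1 - b' / a') ` hp" "fk' = Gam fim gm (1 - b' / a') ` hm" and "b' \<noteq> a'"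
    for fk fk' gp gm hp hm \<tau> a' b'
  proof -
    have "fk' = (op_exp (\<lambda>z. b' *\<^sub>R \<tau> z) \<circ> Gam fip gp (1 - b' / a') \<circ> op_exp (\<lambda>z. - b' *\<^sub>R \<tau>i z)) ` op_exp (\<lambda>z. b' *\<^sub>R \<tau>i z) ` hp"
      using e[unfolded isotropic_edge_def, THEN conjunct2, rule_format, OF \<open>b' \<noteq> a'\<close>]
      unfolding k h by (rule arg_cong[where f = "\<lambda>G. G ` X" for X])
    also have "\<dots> = op_exp (\<lambda>z. b' *\<^sub>R \<tau> z) ` Gam fip gp (1 - b' / a') ` hp"
      by (simp only: image_comp o_assoc[symmetric]) (simp only: image_comp[symmetric] o_def op_exp_inverse(2)[OF i])
    finally show ?thesis unfolding k(1) .
  qed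
  have jm: "fjm = op_exp (\<lambda>z. a *\<^sub>R \<tau>i z) ` fjp" and lm: "flm = op_exp (\<lambda>z. b *\<^sub>R \<tau>i z) ` flp"
    by (rule ij[unfolded isotropic_edge_def, THEN conjunct1] il[unfolded isotropic_edge_def, THEN conjunct1])+
  have kj: "fkm = op_exp (\<lambda>z. b *\<^sub>R \<tau>j z) ` fkp"
    using km_exp[OF ij lm kp km] ab by blast
  have kl: "fkm = op_exp (\<lambda>z. a *\<^sub>R \<tau>l z) ` fkp"
    using km_exp[OF il jm sqp(2) sqm(2)] ab by blast
  obtain \<tau>k where \<tau>k: "spans_null_plane fkp fkm \<tau>k" "isotropic_edge fjp fjm \<tau>j fkp fkm \<tau>k b"
    using isotropic_edge_exists[OF j sqp(1) kj nop(3) nom(3) ab(2)] by blast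
  obtain \<tau>k' where \<tau>k': "spans_null_plane fkp fkm \<tau>k'" "isotropic_edge flp flm \<tau>l fkp fkm \<tau>k' a"
    using isotropic_edge_exists[OF l sqp(1) kl nop(4) nom(4) ab(1)] by blast
  define t where "t = \<bar>a\<bar> + \<bar>b\<bar> + 1"
  have t: "t \<noteq> 0" "t \<noteq> a" "t \<noteq> b" unfolding t_def by linarith+
  let ?G = "\<lambda>f g c. Gam f g (1 - t / c)" and ?e = "\<lambda>\<tau> z. op_exp (\<lambda>z. t *\<^sub>R \<tau> z) z" and ?e' = "\<lambda>\<tau> z. op_exp (\<lambda>z. - t *\<^sub>R \<tau> z) z"
  have e: "?G fjm fkm b = ?e \<tau>k \<circ> ?G fjp fkp b \<circ> ?e' \<tau>j" "?G flm fkm a = ?e \<tau>k' \<circ> ?G flp fkp a \<circ> ?e' \<tau>l"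
    "?G fim fjm a = ?e \<tau>j \<circ> ?G fip fjp a \<circ> ?e' \<tau>i" "?G fim flm b = ?e \<tau>l \<circ> ?G fip flp b \<circ> ?e' \<tau>i"
    by (rule \<tau>k(2)[unfolded isotropic_edge_def, THEN conjunct2, rule_format, OF t(3)]
        \<tau>k'(2)[unfolded isotropic_edge_def, THEN conjunct2, rule_format, OF t(2)]
        ij[unfolded isotropic_edge_def, THEN conjunct2, rule_format, OF t(2)]
        il[unfolded isotropic_edge_def, THEN conjunct2, rule_format, OF t(3)])+
  have "?e \<tau>k (?G fjp fkp b (?G fip fjp a x)) = ?e \<tau>k' (?G flp fkp a (?G fip flp b x))" for x
    using fun_cong[OF sqm(3)[OF t(2,3)], of "?e \<tau>i x"] unfolding e
    by (simp only: o_apply op_exp_inverse(2)[OF i] op_exp_inverse(2)[OF j] op_exp_inverse(2)[OF l])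
  moreover have "?G fjp fkp b (?G fip fjp a x) = ?G flp fkp a (?G fip flp b x)" for x
    using fun_cong[OF sqp(3)[OF t(2,3)], of x] by simp
  ultimately have eq: "?e \<tau>k (?G flp fkp a (?G fip flp b x)) = ?e \<tau>k' (?G flp fkp a (?G fip flp b x))" for x
    by simp
  have "1 - t / b \<noteq> 0" using t ab by simp
  note G = Gam_inverse(1)[OF spans_null_planeD(1)[OF i] spans_null_planeD(1)[OF l] nop(2) this]
  have "?e \<tau>k (?G flp fkp a x) = ?e \<tau>k' (?G flp fkp a x)" for x
    using eq[of "Gam fip flp (inverse (1 - t / b)) x"] unfolding G .
  then have "?e \<tau>k \<circ> ?G flp fkp a \<circ> ?e' \<tau>l = ?e \<tau>k' \<circ> ?G flp fkp a \<circ> ?e' \<tau>l"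
    by (simp add: fun_eq_iff)
  then have "\<tau>k = \<tau>k'"
    by (rule isotropic_edge_unique[OF \<tau>k(1) \<tau>k'(1) l nop(4) t(1,2) ab(1)])
  with \<tau>k \<tau>k'(2) show thesis using that by blast
qed

text \<open>The values on the boundary row and column extend to the quadrant by filling one square after
  another: inside a row from left to right, starting with the given entry of the column.\<close>

lemma isotropic_lattice:
  assumes row: "\<And>m. spans_null_plane (Fp m 0) (Fm m 0) (r m)"
      "\<And>m. isotropic_edge (Fp m 0) (Fm m 0) (r m) (Fp (Suc m) 0) (Fm (Suc m) 0) (r (Suc m)) (\<alpha> m)"
    and column: "\<And>n. spans_null_plane (Fp 0 n) (Fm 0 n) (s n)"
      "\<And>n. isotropic_edge (Fp 0 n) (Fm 0 n) (s n) (Fp 0 (Suc n)) (Fm 0 (Suc n)) (s (Suc n)) (\<beta> n)"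
    and corner: "s 0 = r 0"
    and permuted: "\<And>m n. Fp (Suc m) (Suc n) = Gam (Fp m n) (Fp (Suc m) n) (1 - \<beta> n / \<alpha> m) ` Fp m (Suc n)"
      "\<And>m n. Fm (Suc m) (Suc n) = Gam (Fm m n) (Fm (Suc m) n) (1 - \<beta> n / \<alpha> m) ` Fm m (Suc n)"
    and params: "\<And>m. \<alpha> m \<noteq> 0" "\<And>n. \<beta> n \<noteq> 0" "\<And>m n. \<alpha> m \<noteq> \<beta> n"
    and nonorth: "\<And>m n. \<not> orthogonal_lines (Fp m n) (Fp (Suc m) n)"
      "\<And>m n. \<not> orthogonal_lines (Fp m n) (Fp m (Suc n))"
      "\<And>m n. \<not> orthogonal_lines (Fm m n) (Fm (Suc m) n)"
      "\<And>m n. \<not> orthogonal_lines (Fm m n) (Fm m (Suc n))"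
  obtains \<tau> where "\<And>m n. spans_null_plane (Fp m n) (Fm m n) (\<tau> m n)"
    "\<And>m n. isotropic_edge (Fp m n) (Fm m n) (\<tau> m n) (Fp (Suc m) n) (Fm (Suc m) n) (\<tau> (Suc m) n) (\<alpha> m)"
    "\<And>m n. isotropic_edge (Fp m n) (Fm m n) (\<tau> m n) (Fp m (Suc n)) (Fm m (Suc n)) (\<tau> m (Suc n)) (\<beta> n)"
proof -
  let ?V = "\<lambda>m n. spans_null_plane (Fp m n) (Fm m n)"
  let ?H = "\<lambda>m n \<tau> \<sigma>. isotropic_edge (Fp m n) (Fm m n) \<tau> (Fp (Suc m) n) (Fm (Suc m) n) \<sigma> (\<alpha> m)"
  let ?W = "\<lambda>m n \<tau> \<sigma>. isotropic_edge (Fp m n) (Fm m n) \<tau> (Fp m (Suc n)) (Fm m (Suc n)) \<sigma> (\<beta> n)"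
  let ?P = "\<lambda>n R. R 0 = s n \<and> (\<forall>m. ?V m n (R m)) \<and> (\<forall>m. ?H m n (R m) (R (Suc m)))"
  let ?Q = "\<lambda>n R R'. \<forall>m. ?W m n (R m) (R' m)"
  have "\<exists>f. \<forall>n. ?P n (f n) \<and> ?Q n (f n) (f (Suc n))"
  proof (rule dependent_nat_choice)
    show "\<exists>R. ?P 0 R"
      by (intro exI[of _ r] conjI allI row corner[symmetric])
    fix R n assume R: "?P n R"
    then have R0: "R 0 = s n" and V: "\<And>m. ?V m n (R m)" and H: "\<And>m. ?H m n (R m) (R (Suc m))"
      by simp_all
    let ?P' = "\<lambda>m \<sigma>. (m = 0 \<longrightarrow> \<sigma> = s (Suc n)) \<and> ?V m (Suc n) \<sigma> \<and> ?W m n (R m) \<sigma>"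
    have "\<exists>g. \<forall>m. ?P' m (g m) \<and> ?H m (Suc n) (g m) (g (Suc m))"
    proof (rule dependent_nat_choice)
      show "\<exists>\<sigma>. ?P' 0 \<sigma>"
        by (intro exI[of _ "s (Suc n)"] conjI impI refl column(1)) (simp only: R0 column(2))
      fix \<sigma> m assume \<sigma>: "?P' m \<sigma>"
      then have \<sigma>V: "?V m (Suc n) \<sigma>" and \<sigma>W: "?W m n (R m) \<sigma>" by simp_all
      obtain \<tau>k where "?V (Suc m) (Suc n) \<tau>k" "?W (Suc m) n (R (Suc m)) \<tau>k" "?H m (Suc n) \<sigma> \<tau>k"
        by (rule isotropic_square[OF V V \<sigma>V H \<sigma>W permuted params nonorth(1,2,2,1) nonorth(3,4,4,3)])
      then show "\<exists>\<sigma>'. ?P' (Suc m) \<sigma>' \<and> ?H m (Suc n) \<sigma> \<sigma>'" by blast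
    qed
    then obtain g where g: "\<And>m. ?P' m (g m) \<and> ?H m (Suc n) (g m) (g (Suc m))" by blast
    show "\<exists>R'. ?P (Suc n) R' \<and> ?Q n R R'"
      by (intro exI[of _ g] conjI allI; use g in simp)
  qed
  then obtain f where f: "\<And>n. ?P n (f n) \<and> ?Q n (f n) (f (Suc n))" by blast
  show thesis
    by (rule that[of "\<lambda>m n. f n m"]; use f in simp)
qed

section \<open>Differentiable sections\<close>

text \<open>Pairing with a vector orthogonal to the subspace gives a function that vanishes near the point,
  hence so does its derivative.\<close>

lemma derivative_in_subspace:
  fixes f :: "'a::real_normed_vector \<Rightarrow> 'b::euclidean_space"
  assumes f: "f differentiable (at u)" and S: "subspace S"
    and N: "open N" "u \<in> N" "\<And>y. y \<in> N \<Longrightarrow> f y \<in> S"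
  shows "frechet_derivative f (at u) v \<in> S"
proof -
  let ?D = "frechet_derivative f (at u)"
  obtain y z where y: "y \<in> span S" and z: "\<And>w. w \<in> span S \<Longrightarrow> orthogonal z w" and D: "?D v = y + z"
    using orthogonal_subspace_decomp_exists[of S "?D v"] by metis
  have "(f has_derivative ?D) (at u)"
    using f by (simp add: frechet_derivative_works)
  then have "((\<lambda>x. z \<bullet> f x) has_derivative (\<lambda>h. z \<bullet> ?D h)) (at u)"
    by (rule has_derivative_inner_right)
  moreover have "((\<lambda>x. z \<bullet> f x) has_derivative (\<lambda>h. 0)) (at u)"
    by (rule has_derivative_transform_within_open[OF has_derivative_const[of 0] N(1,2)])
      (use z N(3) in \<open>simp add: orthogonal_def span_base\<close>)
  ultimately have "z \<bullet> ?D v = 0"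
    using has_derivative_unique by (metis (no_types, lifting))
  moreover have "z \<bullet> y = 0" using z[OF y] by (simp add: orthogonal_def)
  ultimately have "z = 0" unfolding D by (simp add: inner_add_right)
  with D y show ?thesis by (simp add: span_eq_iff[THEN iffD2, OF S])
qed

lemma smooth_on_differentiable:
  assumes "smooth_on S f" "open S" "u \<in> S"
  shows "f differentiable (at u)"
proof -
  have "Ck_on (Suc 0) S f" using assms(1) unfolding smooth_on_def by (rule spec)
  then have "f differentiable_on S" by simp
  with assms(2,3) show ?thesis by (simp add: differentiable_on_eq_differentiable_at)
qed

lemma chart_parametrization:
  assumes "smooth_surface A" "(W, p) \<in> A"
  shows "open W" "continuous_on W p" "open U \<Longrightarrow> open {u \<in> W. p u \<in> U}"
proof -
  have h: "open W" "homeomorphism W (p ` W) p (inv_into W p)"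
    using assms unfolding smooth_surface_def by blast+
  show W: "open W" by (rule h(1))
  show c: "continuous_on W p" using h(2) by (rule homeomorphism_cont1)
  have "{u \<in> W. p u \<in> U} = W \<inter> p -` U" by blast
  then show "open {u \<in> W. p u \<in> U}" if "open U"
    using continuous_open_preimage[OF c W that] by simp
qed

lemma smooth_section_differentiable:
  assumes "smooth_surface A" "(W, p) \<in> A" "open U" "smooth_section A U \<phi>" "u \<in> W" "p u \<in> U"
  shows "(\<phi> \<circ> p) differentiable (at u)"
proof (rule smooth_on_differentiable)
  show "smooth_on {u \<in> W. p u \<in> U} (\<phi> \<circ> p)"
    using assms(2,4) unfolding smooth_section_def by blast
  show "open {u \<in> W. p u \<in> U}" using assms(1-3) by (rule chart_parametrization(3))
qed (use assms in simp)

lemma smooth_endo_differentiable: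
  assumes "smooth_surface A" "smooth_endo A \<tau>"
  shows "differentiable_section A (\<lambda>x. \<tau> x z)"
  unfolding differentiable_section_def
proof (clarify)
  fix W p and u :: "real^2" assume u: "(W, p) \<in> A" "u \<in> W"
  have "smooth_section A UNIV (\<lambda>x. \<tau> x z)" using assms(2) unfolding smooth_endo_def by (rule spec)
  from smooth_section_differentiable[OF assms(1) u(1) open_UNIV this u(2) UNIV_I]
  show "((\<lambda>x. \<tau> x z) \<circ> p) differentiable (at u)" .
qed

lemma differentiable_sectionD:
  "differentiable_section A \<phi> \<Longrightarrow> (W, p) \<in> A \<Longrightarrow> u \<in> W \<Longrightarrow> (\<lambda>u. \<phi> (p u)) differentiable (at u)"
  unfolding differentiable_section_def o_def by blast

lemma differentiable_sectionI:
  "(\<And>W p u. (W, p) \<in> A \<Longrightarrow> u \<in> W \<Longrightarrow> (\<lambda>u. \<phi> (p u)) differentiable (at u)) \<Longrightarrow> differentiable_section A \<phi>"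
  unfolding differentiable_section_def o_def by blast

lemma differentiable_section_const: "differentiable_section A (\<lambda>_. z)"
  by (rule differentiable_sectionI) simp

lemma differentiable_section_apply:
  assumes "\<And>x. linear (\<tau> x)" "\<And>z. differentiable_section A (\<lambda>x. \<tau> x z)" "differentiable_section A \<phi>"
  shows "differentiable_section A (\<lambda>x. \<tau> x (\<phi> x))"
proof (rule differentiable_sectionI)
  fix W p u assume u: "(W, p) \<in> A" "u \<in> W"
  have "\<tau> x (\<phi> x) = (\<Sum>b\<in>Basis. (\<phi> x \<bullet> b) *\<^sub>R \<tau> x b)" for x
  proof -
    have "\<tau> x (\<phi> x) = \<tau> x (\<Sum>b\<in>Basis. (\<phi> x \<bullet> b) *\<^sub>R b)" by (simp only: euclidean_representation)
    then show ?thesis by (simp only: linear_sum[OF assms(1)] linear_cmul[OF assms(1)])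
  qed
  moreover have "(\<lambda>u. \<Sum>b\<in>Basis. (\<phi> (p u) \<bullet> b) *\<^sub>R \<tau> (p u) b) differentiable (at u)"
    using differentiable_sectionD[OF assms(2) u] differentiable_sectionD[OF assms(3) u]
    by (intro differentiable_sum differentiable_scaleR differentiable_inner ballI) simp_all
  ultimately show "(\<lambda>u. \<tau> (p u) (\<phi> (p u))) differentiable (at u)" by simp
qed

lemma differentiable_ip:
  assumes "f differentiable (at u)" "g differentiable (at u)"
  shows "(\<lambda>x. ip (f x) (g x)) differentiable (at u)"
  using assms bounded_bilinear.FDERIV[OF bounded_bilinear_ip] unfolding differentiable_def by blast

text \<open>Locally there are smooth generators, and in terms of these \<open>\<Gamma>\<close> is a rational expression with
  denominator \<open>(\<sigma>, \<rho>) \<noteq> 0\<close>.\<close>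

lemma differentiable_section_Gam:
  assumes A: "smooth_surface A" and f: "smooth_line_map A f" and g: "smooth_line_map A g"
    and nonorth: "\<And>x. \<not> orthogonal_lines (f x) (g x)" and s: "s \<noteq> 0" and \<phi>: "differentiable_section A \<phi>"
  shows "differentiable_section A (\<lambda>x. Gam (f x) (g x) s (\<phi> x))"
proof (rule differentiable_sectionI)
  fix W p u assume u: "(W, p) \<in> A" "u \<in> W"
  obtain U \<sigma> where U: "open U" "p u \<in> U" "smooth_section A U \<sigma>" and \<sigma>: "\<And>y. y \<in> U \<Longrightarrow> f y = span {\<sigma> y}"
    using f unfolding smooth_line_map_def by metis
  obtain V \<rho> where V: "open V" "p u \<in> V" "smooth_section A V \<rho>" and \<rho>: "\<And>y. y \<in> V \<Longrightarrow> g y = span {\<rho> y}"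
    using g unfolding smooth_line_map_def by metis
  have null: "null_line (f y)" "null_line (g y)" for y
    using f g unfolding smooth_line_map_def by blast+
  have UV: "ip (\<sigma> y) (\<rho> y) \<noteq> 0" "Gam (f y) (g y) s (\<phi> y) = boost (\<sigma> y) (\<rho> y) s (\<phi> y)" if y: "y \<in> U" "y \<in> V" for y
  proof -
    show nz: "ip (\<sigma> y) (\<rho> y) \<noteq> 0"
      using nonorth[of y] unfolding \<sigma>[OF y(1)] \<rho>[OF y(2)] orthogonal_lines_span .
    show "Gam (f y) (g y) s (\<phi> y) = boost (\<sigma> y) (\<rho> y) s (\<phi> y)"
      unfolding \<sigma>[OF y(1)] \<rho>[OF y(2)]
      using Gam_span null_line_generator[OF null(1) \<sigma>[OF y(1)]] null_line_generator[OF null(2) \<rho>[OF y(2)]] nz s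
      by simp
  qed
  have d: "(\<lambda>u. \<sigma> (p u)) differentiable (at u)" "(\<lambda>u. \<rho> (p u)) differentiable (at u)"
    "(\<lambda>u. \<phi> (p u)) differentiable (at u)"
    using smooth_section_differentiable[OF A u(1) U(1,3) u(2) U(2)]
      smooth_section_differentiable[OF A u(1) V(1,3) u(2) V(2)] differentiable_sectionD[OF \<phi> u]
    by (simp_all add: o_def)
  have "(\<lambda>u. boost (\<sigma> (p u)) (\<rho> (p u)) s (\<phi> (p u))) differentiable (at u)"
    unfolding boost_def
    by (intro differentiable_add differentiable_scaleR differentiable_divide differentiable_mult
        differentiable_ip differentiable_const d UV(1) U V)
  then obtain D where D: "((\<lambda>u. boost (\<sigma> (p u)) (\<rho> (p u)) s (\<phi> (p u))) has_derivative D) (at u)"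
    unfolding differentiable_def by (elim exE)
  let ?N = "{u \<in> W. p u \<in> U \<inter> V}"
  have "((\<lambda>u. Gam (f (p u)) (g (p u)) s (\<phi> (p u))) has_derivative D) (at u)"
  proof (rule has_derivative_transform_within_open[OF D])
    show "open ?N" using U(1) V(1) by (intro chart_parametrization(3)[OF A u(1)] open_Int)
    show "u \<in> ?N" using u U V by simp
  qed (use UV(2) in simp)
  then show "(\<lambda>u. Gam (f (p u)) (g (p u)) s (\<phi> (p u))) differentiable (at u)"
    by (rule differentiableI)
qed

section \<open>Uniqueness of the gauge of a smooth surface\<close>

lemma wedge_sub_null_plane:
  assumes "null_plane (f \<oplus>\<^sub>s g)" "null_line f" "null_line g" "\<tau> \<in> wedge_sub f g"
  shows "linear \<tau>" "op_exp (\<lambda>z. t *\<^sub>R \<tau> z) = (\<lambda>z. z + t *\<^sub>R \<tau> z)" "\<tau> (\<tau> z) = 0"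
proof -
  obtain u v where uv: "u \<in> f" "v \<in> g" "\<tau> = wedge u v"
    using assms(4) unfolding wedge_sub_def by blast
  obtain a b where ab: "f = span {a}" "g = span {b}" using assms(2,3) unfolding null_line_def by blast
  have "u + 0 \<in> f \<oplus>\<^sub>s g" "0 + v \<in> f \<oplus>\<^sub>s g"
    unfolding plus_sub_def ab using uv ab span_zero by blast+
  then have null: "ip u u = 0" "ip u v = 0" "ip v v = 0"
    using assms(1) unfolding null_plane_def by simp_all
  show "linear \<tau>" "op_exp (\<lambda>z. t *\<^sub>R \<tau> z) = (\<lambda>z. z + t *\<^sub>R \<tau> z)" "\<tau> (\<tau> z) = 0"
    unfolding uv(3) using linear_wedge op_exp_wedge[OF null] wedge_square[OF null] by blast+
qed

lemma wedge_sub_diff: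
  assumes "null_line f" "null_line g" "\<tau> \<in> wedge_sub f g" "\<sigma> \<in> wedge_sub f g"
  shows "(\<lambda>z. \<tau> z - \<sigma> z) \<in> wedge_sub f g"
proof -
  obtain u v where uv: "f = span {u}" "g = span {v}" using assms(1,2) unfolding null_line_def by blast
  have *: "\<exists>r. \<rho> = (\<lambda>z. r *\<^sub>R wedge u v z)" if \<rho>: "\<rho> \<in> wedge_sub f g" for \<rho>
  proof -
    obtain x y where xy: "x \<in> f" "y \<in> g" "\<rho> = wedge x y" using \<rho> unfolding wedge_sub_def by blast
    obtain a where a: "x = a *\<^sub>R u" using xy(1) unfolding uv mem_line by (elim exE)
    obtain b where b: "y = b *\<^sub>R v" using xy(2) unfolding uv mem_line by (elim exE)
    have "\<rho> = (\<lambda>z. (a * b) *\<^sub>R wedge u v z)"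
      unfolding xy(3) a b wedge_scale_left wedge_scale_right by (simp add: mult.commute)
    then show ?thesis by (rule exI)
  qed
  obtain r s where "\<tau> = (\<lambda>z. r *\<^sub>R wedge u v z)" "\<sigma> = (\<lambda>z. s *\<^sub>R wedge u v z)"
    using *[OF assms(3)] *[OF assms(4)] by (elim exE)
  then have "(\<lambda>z. \<tau> z - \<sigma> z) = wedge u ((r - s) *\<^sub>R v)"
    unfolding wedge_scale_right by (simp add: scaleR_left_diff_distrib)
  moreover have "u \<in> f" "(r - s) *\<^sub>R v \<in> g" unfolding uv by (simp_all add: span_base span_scale)
  ultimately show ?thesis unfolding wedge_sub_def by blast
qed

text \<open>A weakening of \<^const>\<open>isotropic_gauge\<close> that the algebraically transported \<open>\<tau>\<close> is seen to satisfy: it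
  is differentiable, and the gauge relation holds where the connections of the Darboux transforms
  are related by \<open>\<Gamma>\<close>, that is, away from \<open>t = \<mu>\<close>.\<close>

definition gauge_except :: "'a::topological_space param set \<Rightarrow> ('a \<Rightarrow> r42 set) \<Rightarrow> 'a one_form \<Rightarrow>
   ('a \<Rightarrow> r42 set) \<Rightarrow> 'a one_form \<Rightarrow> real \<Rightarrow> ('a \<Rightarrow> r42 \<Rightarrow> r42) \<Rightarrow> bool" where
  "gauge_except A fp \<eta>p fm \<eta>m \<mu> \<tau> \<longleftrightarrow>
     (\<forall>z. differentiable_section A (\<lambda>x. \<tau> x z)) \<and> (\<forall>x. \<tau> x \<in> wedge_sub (fp x) (fm x)) \<and>
     (\<forall>t. t \<noteq> \<mu> \<longrightarrow> conn_eq A (conn \<eta>m t)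
            (gauge (\<lambda>x. op_exp (\<lambda>z. t *\<^sub>R \<tau> x z)) (conn \<eta>p t)
                   (\<lambda>x. op_exp (\<lambda>z. (- t) *\<^sub>R \<tau> x z))))"

lemma isotropic_gauge_except:
  assumes "smooth_surface A" "isotropic_gauge A fp \<eta>p fm \<eta>m \<tau>"
  shows "gauge_except A fp \<eta>p fm \<eta>m \<mu> \<tau>"
  using assms smooth_endo_differentiable[OF assms(1)] unfolding gauge_except_def isotropic_gauge_def by blast

text \<open>Applied to constant sections, the gauge relation divided by \<open>t\<close> is a polynomial identity in \<open>t\<close>, and
  its constant term is \<open>d\<tau> = \<eta>\<^sup>+ - \<eta>\<^sup>-\<close>.\<close>

lemma gauge_derivative:
  assumes planes: "\<And>x. null_plane (fp x \<oplus>\<^sub>s fm x)" "\<And>x. null_line (fp x)" "\<And>x. null_line (fm x)"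
    and \<eta>: "smooth_one_form A \<eta>p" and \<tau>: "gauge_except A fp \<eta>p fm \<eta>m \<mu> \<tau>" and \<mu>: "\<mu> \<noteq> 0"
    and u: "(W, p) \<in> A" "u \<in> W"
  shows "((\<lambda>u. \<tau> (p u) z) has_derivative (\<lambda>v. \<eta>p (W, p) u v z - \<eta>m (W, p) u v z)) (at u)"
proof -
  have \<tau>w: "\<tau> x \<in> wedge_sub (fp x) (fm x)" and diff: "differentiable_section A (\<lambda>x. \<tau> x z)" for x z
    using \<tau> unfolding gauge_except_def by blast+
  note \<tau>s = wedge_sub_null_plane[OF planes \<tau>w]
  let ?D = "frechet_derivative (\<lambda>u. \<tau> (p u) z) (at u)"
  have D: "((\<lambda>u. \<tau> (p u) z) has_derivative ?D) (at u)"
    using differentiable_sectionD[OF diff u] by (simp only: frechet_derivative_works)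
  have lin: "linear (\<eta>p (W, p) u v)" for v
    using \<eta> u unfolding smooth_one_form_def by fastforce
  have "?D v = \<eta>p (W, p) u v z - \<eta>m (W, p) u v z" for v
  proof -
    let ?\<tau> = "\<tau> (p u)" and ?P = "\<eta>p (W, p) u v"
    define a where "a = ?P z - ?D v"
    define b where "b = ?\<tau> a - ?P (?\<tau> z)"
    define c where "c = - ?\<tau> (?P (?\<tau> z))"
    have key: "a + t *\<^sub>R b + (t * t) *\<^sub>R c = \<eta>m (W, p) u v z" if t: "t \<noteq> \<mu>" "t \<noteq> 0" for t
    proof -
      have "conn_eq A (conn \<eta>m t) (gauge (\<lambda>x. op_exp (\<lambda>z. t *\<^sub>R \<tau> x z)) (conn \<eta>p t)
                   (\<lambda>x. op_exp (\<lambda>z. (- t) *\<^sub>R \<tau> x z)))"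
        using \<tau> t unfolding gauge_except_def by blast
      from this[unfolded conn_eq_def, rule_format, OF differentiable_section_const u(1), of u z v]
      have "conn \<eta>m t (\<lambda>_. z) (W, p) u v =
        gauge (\<lambda>x. op_exp (\<lambda>z. t *\<^sub>R \<tau> x z)) (conn \<eta>p t) (\<lambda>x. op_exp (\<lambda>z. (- t) *\<^sub>R \<tau> x z)) (\<lambda>_. z) (W, p) u v"
        using u(2) by simp
      moreover have "conn \<eta>m t (\<lambda>_. z) (W, p) u v = t *\<^sub>R \<eta>m (W, p) u v z"
        unfolding conn_def section_deriv_def by (simp add: o_def frechet_derivative_const)
      moreover have "conn \<eta>p t (\<lambda>x. z + (- t) *\<^sub>R \<tau> x z) (W, p) u v =
          (- t) *\<^sub>R ?D v + t *\<^sub>R ?P (z + (- t) *\<^sub>R ?\<tau> z)"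
      proof -
        have "((\<lambda>u. z + (- t) *\<^sub>R \<tau> (p u) z) has_derivative (\<lambda>v. (- t) *\<^sub>R ?D v)) (at u)"
          using has_derivative_add[OF has_derivative_const[of z] has_derivative_scaleR_right[OF D, of "- t"]] by simp
        from frechet_derivative_at[OF this, symmetric] show ?thesis
          unfolding conn_def section_deriv_def by (simp add: o_def)
      qed
      ultimately have "t *\<^sub>R \<eta>m (W, p) u v z = ((- t) *\<^sub>R ?D v + t *\<^sub>R ?P (z + (- t) *\<^sub>R ?\<tau> z)) +
          t *\<^sub>R ?\<tau> ((- t) *\<^sub>R ?D v + t *\<^sub>R ?P (z + (- t) *\<^sub>R ?\<tau> z))"
        unfolding gauge_def \<tau>s(2) by simp
      also have "\<dots> = t *\<^sub>R (a + t *\<^sub>R b + (t * t) *\<^sub>R c)"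
        unfolding a_def b_def c_def
        by (simp only: linear_add[OF lin] linear_cmul[OF lin] linear_diff[OF \<tau>s(1)] linear_add[OF \<tau>s(1)] linear_cmul[OF \<tau>s(1)])
          (simp add: algebra_simps)
      finally show ?thesis using t(2) by simp
    qed
    have "w \<bullet> a = w \<bullet> \<eta>m (W, p) u v z" for w
    proof -
      define h where "h = \<mu> / 4"
      have key': "w \<bullet> a + t * (w \<bullet> b) + t * t * (w \<bullet> c) = w \<bullet> \<eta>m (W, p) u v z"
        if "t \<noteq> \<mu>" "t \<noteq> 0" for t
        unfolding key[OF that, symmetric] by (simp add: inner_add_right)
      show ?thesis
        \<comment> \<open>Four values of \<open>t\<close> away from \<open>0\<close> and \<open>\<mu>\<close> isolate the constant term of a quadratic polynomial.\<close>
        using key'[of h] key'[of "- h"] key'[of "2 * h"] key'[of "- 2 * h"] \<mu>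
        by (simp add: h_def)
    qed
    then have "a = \<eta>m (W, p) u v z" using vector_eq_ldot by blast
    then show ?thesis unfolding a_def by (simp add: algebra_simps)
  qed
  then have "?D = (\<lambda>v. \<eta>p (W, p) u v z - \<eta>m (W, p) u v z)" by (rule ext)
  with D show ?thesis by simp
qed

text \<open>Two gauges have the same derivative, so their difference is locally constant. If it were nonzero
  somewhere, then its image, which is the null plane \<open>f\<^sup>+ \<oplus> f\<^sup>-\<close>, would be locally constant there, and
  the Legendre map would not be an immersion.\<close>

lemma gauge_unique:
  fixes A :: "'a::{t2_space,second_countable_topology} param set"
  assumes A: "smooth_surface A" and \<Lambda>: "legendre_immersion A (\<lambda>x. fp x \<oplus>\<^sub>s fm x)"
    and lines: "\<And>x. null_line (fp x)" "\<And>x. null_line (fm x)" and \<eta>: "smooth_one_form A \<eta>p"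
    and \<tau>: "gauge_except A fp \<eta>p fm \<eta>m \<mu> \<tau>" and \<sigma>: "gauge_except A fp \<eta>p fm \<eta>m \<mu> \<sigma>" and \<mu>: "\<mu> \<noteq> 0"
  shows "\<tau> = \<sigma>"
proof (rule ccontr)
  assume "\<tau> \<noteq> \<sigma>"
  then obtain x z where xz: "\<tau> x z \<noteq> \<sigma> x z" by (metis ext)
  have planes: "null_plane (fp y \<oplus>\<^sub>s fm y)" for y
    by (rule \<Lambda>[unfolded legendre_immersion_def smooth_plane_map_def, THEN conjunct1, THEN conjunct1, THEN spec])
  have "x \<in> (\<Union>(W, p)\<in>A. p ` W)" using A unfolding smooth_surface_def by simp
  then obtain W p u where u: "(W, p) \<in> A" "u \<in> W" and x: "x = p u" by auto
  obtain e where e: "e > 0" "ball u e \<subseteq> W"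
    using chart_parametrization(1)[OF A u(1)] u(2) open_contains_ball by metis
  define \<delta> where "\<delta> y = (\<lambda>z. \<tau> y z - \<sigma> y z)" for y
  have const: "\<delta> (p u') = \<delta> (p u)" if u': "u' \<in> ball u e" for u'
  proof
    fix z
    show "\<delta> (p u') z = \<delta> (p u) z"
    proof (rule has_derivative_zero_unique[of "ball u e" "\<lambda>u. \<delta> (p u) z"])
      fix y assume "y \<in> ball u e"
      then have y: "y \<in> W" using e by blast
      have "((\<lambda>u. \<tau> (p u) z - \<sigma> (p u) z) has_derivative (\<lambda>h. 0)) (at y)"
        using has_derivative_diff[OF gauge_derivative[OF planes lines \<eta> \<tau> \<mu> u(1) y] gauge_derivative[OF planes lines \<eta> \<sigma> \<mu> u(1) y], of z z]
        by simp
      then show "((\<lambda>u. \<delta> (p u) z) has_derivative (\<lambda>h. 0)) (at y within ball u e)"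
        unfolding \<delta>_def by (rule has_derivative_at_withinI)
    qed (use u' e in simp_all)
  qed
  have "\<delta> x z \<noteq> 0" using xz unfolding \<delta>_def by simp
  then have nz: "\<delta> (p u) \<noteq> (\<lambda>_. 0)" unfolding x by (metis)
  have "\<delta> y \<in> wedge_sub (fp y) (fm y)" for y
    unfolding \<delta>_def using \<tau> \<sigma> lines by (intro wedge_sub_diff) (simp_all add: gauge_except_def)
  then have "spans_null_plane (fp (p u')) (fm (p u')) (\<delta> (p u))" if "u' \<in> ball u e" for u'
    using spans_null_planeI[OF planes lines] nz const[OF that] by metis
  then have \<Lambda>const: "fp (p u') \<oplus>\<^sub>s fm (p u') = range (\<delta> (p u))" if "u' \<in> ball u e" for u'
    using spans_null_plane_range that by metis
  have u_ball: "u \<in> ball u e" using e by simp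
  have "(axis 1 1 :: real^2) \<noteq> 0" by (simp add: axis_eq_0_iff)
  with \<Lambda>[unfolded legendre_immersion_def, THEN conjunct2, THEN conjunct2, rule_format, OF u(1)] u(2)
  have "\<exists>U \<rho>. open U \<and> p u \<in> U \<and> smooth_section A U \<rho> \<and> (\<forall>y\<in>U. \<rho> y \<in> fp y \<oplus>\<^sub>s fm y) \<and>
      section_deriv \<rho> (W, p) u (axis 1 1) \<notin> fp (p u) \<oplus>\<^sub>s fm (p u)"
    by (simp only: fst_conv snd_conv)
  then obtain U \<rho> where U: "open U" "p u \<in> U" "smooth_section A U \<rho>" and \<rho>: "\<And>y. y \<in> U \<Longrightarrow> \<rho> y \<in> fp y \<oplus>\<^sub>s fm y"
    and out: "section_deriv \<rho> (W, p) u (axis 1 1) \<notin> fp (p u) \<oplus>\<^sub>s fm (p u)"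
    by (elim exE conjE) blast
  have "section_deriv \<rho> (W, p) u (axis 1 1) \<in> fp (p u) \<oplus>\<^sub>s fm (p u)"
    unfolding section_deriv_def snd_conv
  proof (rule derivative_in_subspace)
    show "(\<rho> \<circ> p) differentiable (at u)"
      by (rule smooth_section_differentiable[OF A u(1) U(1,3) u(2) U(2)])
    show "subspace (fp (p u) \<oplus>\<^sub>s fm (p u))" using planes unfolding null_plane_def by blast
    show "open ({u \<in> W. p u \<in> U} \<inter> ball u e)"
      using chart_parametrization(3)[OF A u(1) U(1)] by (intro open_Int open_ball)
    show "u \<in> {u \<in> W. p u \<in> U} \<inter> ball u e" using u U u_ball by simp
    show "(\<rho> \<circ> p) y \<in> fp (p u) \<oplus>\<^sub>s fm (p u)" if "y \<in> {u \<in> W. p u \<in> U} \<inter> ball u e" for y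
      using \<rho>[of "p y"] that \<Lambda>const[of y] \<Lambda>const[OF u_ball] by simp
  qed
  with out show False by contradiction
qed

section \<open>Edges given by Lie-Darboux transforms\<close>

text \<open>The connections of the transforms are \<open>\<Gamma>\<^sup>\<plusminus>_ji(t) \<circ> \<Gamma>\<^sup>\<plusminus>(t) \<circ> \<Gamma>\<^sup>\<plusminus>_ji(t)\<^sup>-\<^sup>1\<close>. Inserting the gauge relation of the
  initial pair and the edge relation \<open>\<Gamma>\<^sup>-_ji(t) exp(t\<tau>) = exp(t\<sigma>) \<Gamma>\<^sup>+_ji(t)\<close> shows that \<open>exp(t\<sigma>)\<close> gauges the
  one into the other. The edge relation also gives the differentiability of \<open>\<sigma>\<close>, since all its other
  factors map differentiable sections to differentiable sections.\<close>

lemma darboux_transform_gauge: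
  fixes A :: "'a::{t2_space,second_countable_topology} param set"
  assumes A: "smooth_surface A"
    and fp: "smooth_line_map A fp" and fm: "smooth_line_map A fm"
    and Dp: "darboux_transform A fp \<eta>p gp \<theta>p \<mu>" and Dm: "darboux_transform A fm \<eta>m gm \<theta>m \<mu>"
    and \<tau>: "isotropic_gauge A fp \<eta>p fm \<eta>m \<tau>"
    and i: "\<And>x. spans_null_plane (fp x) (fm x) (\<tau> x)" and j: "\<And>x. spans_null_plane (gp x) (gm x) (\<sigma> x)"
    and ij: "\<And>x. isotropic_edge (fp x) (fm x) (\<tau> x) (gp x) (gm x) (\<sigma> x) \<mu>"
  shows "gauge_except A gp \<theta>p gm \<theta>m \<mu> \<sigma>"
proof -
  have \<mu>: "\<mu> \<noteq> 0" and gp: "smooth_line_map A gp" and gm: "smooth_line_map A gm"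
    and nop: "\<And>x. \<not> orthogonal_lines (fp x) (gp x)" and nom: "\<And>x. \<not> orthogonal_lines (fm x) (gm x)"
    using Dp Dm unfolding darboux_transform_def by blast+
  define e where "e t = (\<lambda>x. op_exp (\<lambda>z. t *\<^sub>R \<tau> x z))" for t
  define d where "d t = (\<lambda>x. op_exp (\<lambda>z. t *\<^sub>R \<sigma> x z))" for t
  have e_def': "e t x z = z + t *\<^sub>R \<tau> x z" and d_def': "d t x z = z + t *\<^sub>R \<sigma> x z" for t x z
    unfolding e_def d_def spans_null_planeD(6)[OF i] spans_null_planeD(6)[OF j] by (rule refl)+
  have ee: "e (- t) x (e t x z) = z" and dd: "d (- t) x (d t x z) = z" for t x z
    unfolding e_def d_def by (rule op_exp_inverse(2)[OF i] op_exp_inverse(2)[OF j])+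
  define Gp where "Gp t = (\<lambda>x. Gam (fp x) (gp x) (1 - t / \<mu>))" for t
  define Gm where "Gm t = (\<lambda>x. Gam (fm x) (gm x) (1 - t / \<mu>))" for t
  have s: "1 - t / \<mu> \<noteq> 0" if "t \<noteq> \<mu>" for t using that \<mu> by simp
  note invp = Gam_inverse[OF spans_null_planeD(1)[OF i] spans_null_planeD(1)[OF j] nop s]
  note invm = Gam_inverse[OF spans_null_planeD(2)[OF i] spans_null_planeD(2)[OF j] nom s]
  have edge: "Gm t x z = d t x (Gp t x (e (- t) x z))" if "t \<noteq> \<mu>" for t x z
    using ij[unfolded isotropic_edge_def, THEN conjunct2, rule_format, OF that, of x]
    unfolding Gm_def Gp_def e_def d_def by simp
  have edge': "Gm t x (e t x z) = d t x (Gp t x z)" if "t \<noteq> \<mu>" for t x z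
    unfolding edge[OF that] ee ..
  have Gm_inv: "Gm t x (inv (Gm t x) z) = z" and Gp_inv: "inv (Gp t x) (Gp t x z) = z" if "t \<noteq> \<mu>" for t x z
    unfolding Gm_def Gp_def invm(3)[OF that] invp(3)[OF that] by (rule invm(1)[OF that] invp(2)[OF that])+
  have dG: "d (- t) x z = Gp t x (e (- t) x (inv (Gm t x) z))" if "t \<noteq> \<mu>" for t x z
    using edge[OF that, of x "inv (Gm t x) z"] unfolding Gm_inv[OF that] by (metis dd)
  have diff_inv: "differentiable_section A (\<lambda>x. inv (Gm t x) (\<phi> x))" if "t \<noteq> \<mu>" "differentiable_section A \<phi>" for t \<phi>
    unfolding Gm_def invm(3)[OF that(1)]
    by (rule differentiable_section_Gam[OF A fm gm nom _ that(2)]) (use s[OF that(1)] in simp)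
  have diff_\<tau>: "differentiable_section A (\<lambda>x. \<tau> x z)" for z
    using \<tau> smooth_endo_differentiable[OF A] unfolding isotropic_gauge_def by blast
  have diff_e: "differentiable_section A (\<lambda>x. e t x (\<phi> x))" if "differentiable_section A \<phi>" for t \<phi>
    unfolding e_def'
    by (rule differentiable_sectionI)
      (intro differentiable_add differentiable_scaleR differentiable_const differentiable_sectionD[OF that]
        differentiable_sectionD[OF differentiable_section_apply[OF spans_null_planeD(5)[OF i] diff_\<tau> that]])
  have diff_d: "differentiable_section A (\<lambda>x. d (- t) x (\<phi> x))" if "t \<noteq> \<mu>" "differentiable_section A \<phi>" for t \<phi>
    unfolding dG[OF that(1)] Gp_def
    by (rule differentiable_section_Gam[OF A fp gp nop s[OF that(1)] diff_e[OF diff_inv[OF that]]])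
  have "differentiable_section A (\<lambda>x. \<sigma> x z)" for z
  proof (rule differentiable_sectionI)
    fix W p u assume u: "(W, p) \<in> A" "u \<in> W"
    \<comment> \<open>\<open>t = - \<mu>\<close> serves as an admissible value different from 0.\<close>
    have "- \<mu> \<noteq> \<mu>" using \<mu> by simp
    from differentiable_sectionD[OF diff_d[OF this differentiable_section_const] u, of z]
    have "(\<lambda>u. z + \<mu> *\<^sub>R \<sigma> (p u) z) differentiable (at u)" unfolding d_def' by simp
    then have "(\<lambda>u. (1 / \<mu>) *\<^sub>R ((z + \<mu> *\<^sub>R \<sigma> (p u) z) - z)) differentiable (at u)"
      by (intro differentiable_scaleR differentiable_diff differentiable_const)
    then show "(\<lambda>u. \<sigma> (p u) z) differentiable (at u)" using \<mu> by simp
  qed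
  moreover have "conn_eq A (conn \<theta>m t) (gauge (d t) (conn \<theta>p t) (d (- t)))" if t: "t \<noteq> \<mu>" for t
    unfolding conn_eq_def
  proof (intro allI impI ballI)
    fix \<phi> \<kappa> u v assume \<phi>: "differentiable_section A \<phi>" and u: "\<kappa> \<in> A" "u \<in> fst \<kappa>"
    define \<psi> where "\<psi> = (\<lambda>y. inv (Gm t y) (\<phi> y))"
    have \<psi>: "differentiable_section A \<psi>" unfolding \<psi>_def by (rule diff_inv[OF t \<phi>])
    let ?x = "snd \<kappa> u" and ?X = "conn \<eta>p t (\<lambda>y. e (- t) y (\<psi> y)) \<kappa> u v"
    have "conn_eq A (conn \<theta>m t) (gauge (Gm t) (conn \<eta>m t) (\<lambda>x. inv (Gm t x)))"
      and Dp': "conn_eq A (conn \<theta>p t) (gauge (Gp t) (conn \<eta>p t) (\<lambda>x. inv (Gp t x)))"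
      using Dm Dp t unfolding darboux_transform_def Gm_def Gp_def by blast+
    then have "conn \<theta>m t \<phi> \<kappa> u v = Gm t ?x (conn \<eta>m t \<psi> \<kappa> u v)"
      using \<phi> u unfolding conn_eq_def gauge_def \<psi>_def by blast
    also have "conn_eq A (conn \<eta>m t) (gauge (e t) (conn \<eta>p t) (e (- t)))"
      using \<tau> unfolding isotropic_gauge_def e_def by blast
    then have "conn \<eta>m t \<psi> \<kappa> u v = e t ?x ?X"
      using \<psi> u unfolding conn_eq_def gauge_def by blast
    also have "Gm t ?x (e t ?x ?X) = d t ?x (Gp t ?x ?X)" by (rule edge'[OF t])
    also have "Gp t ?x ?X = conn \<theta>p t (\<lambda>y. d (- t) y (\<phi> y)) \<kappa> u v"
    proof -
      have "conn \<theta>p t (\<lambda>y. d (- t) y (\<phi> y)) \<kappa> u v =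
          Gp t ?x (conn \<eta>p t (\<lambda>y. inv (Gp t y) (d (- t) y (\<phi> y))) \<kappa> u v)"
        using Dp'[unfolded conn_eq_def gauge_def, rule_format, OF diff_d[OF t \<phi>] u] .
      then show ?thesis unfolding dG[OF t] Gp_inv[OF t] \<psi>_def by (rule sym)
    qed
    finally show "conn \<theta>m t \<phi> \<kappa> u v = gauge (d t) (conn \<theta>p t) (d (- t)) \<phi> \<kappa> u v"
      unfolding gauge_def .
  qed
  ultimately show ?thesis
    unfolding gauge_except_def d_def using spans_null_planeD(4)[OF j] by blast
qed

lemma omega_surface_planes:
  assumes "omega_surface A fp \<eta>p fm \<eta>m"
  shows "null_plane (fp x \<oplus>\<^sub>s fm x)" "null_line (fp x)" "null_line (fm x)"
    "smooth_line_map A fp" "smooth_line_map A fm" "legendre_immersion A (\<lambda>x. fp x \<oplus>\<^sub>s fm x)"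
    "smooth_one_form A \<eta>p" "isothermic A fp \<eta>p"
proof -
  have iso: "isothermic A fp \<eta>p" "isothermic A fm \<eta>m"
    using assms unfolding omega_surface_def isotropic_darboux_pair_def by simp_all
  show leg: "legendre_immersion A (\<lambda>x. fp x \<oplus>\<^sub>s fm x)"
    using assms unfolding omega_surface_def by (rule conjunct2)
  show "null_plane (fp x \<oplus>\<^sub>s fm x)"
    by (rule leg[unfolded legendre_immersion_def smooth_plane_map_def, THEN conjunct1, THEN conjunct1, THEN spec])
  show maps: "smooth_line_map A fp" "smooth_line_map A fm" and "smooth_one_form A \<eta>p"
    using iso unfolding isothermic_def by simp_all
  show "null_line (fp x)" "null_line (fm x)" using maps unfolding smooth_line_map_def by simp_all
  show "isothermic A fp \<eta>p" by (rule iso)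
qed

lemma isotropic_gauge_unique:
  fixes A :: "'a::{t2_space,second_countable_topology} param set"
  assumes A: "smooth_surface A" and \<Omega>: "omega_surface A fp \<eta>p fm \<eta>m"
    and \<tau>: "isotropic_gauge A fp \<eta>p fm \<eta>m \<tau>" and \<sigma>: "gauge_except A fp \<eta>p fm \<eta>m \<mu> \<sigma>" and \<mu>: "\<mu> \<noteq> 0"
  shows "\<tau> = \<sigma>"
  using A omega_surface_planes(6)[OF \<Omega>] omega_surface_planes(2,3)[OF \<Omega>] omega_surface_planes(7)[OF \<Omega>]
    isotropic_gauge_except[OF A \<tau>] \<sigma> \<mu>
  by (rule gauge_unique)

text \<open>The edge relation holds for the gauge that the transform carries as a smooth \<open>\<Omega>\<close>-surface, because
  the algebraically transported \<open>\<sigma>\<close> is a gauge and gauges are unique. Moreover \<open>\<tau>\<close> has no zeros: at a zero, \<open>g\<^sup>-\<close> and \<open>g\<^sup>+\<close>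
  would coincide instead of spanning a plane.\<close>

lemma lie_darboux_edge:
  fixes A :: "'a::{t2_space,second_countable_topology} param set"
  assumes A: "smooth_surface A"
    and L: "lie_darboux_transform A fp \<eta>p fm \<eta>m gp \<theta>p gm \<theta>m \<mu>"
    and \<Omega>: "omega_surface A gp \<theta>p gm \<theta>m"
    and \<tau>: "isotropic_gauge A fp \<eta>p fm \<eta>m \<tau>" and \<sigma>: "isotropic_gauge A gp \<theta>p gm \<theta>m \<sigma>"
  shows "spans_null_plane (fp x) (fm x) (\<tau> x)"
    "isotropic_edge (fp x) (fm x) (\<tau> x) (gp x) (gm x) (\<sigma> x) \<mu>"
proof -
  have \<Omega>i: "omega_surface A fp \<eta>p fm \<eta>m"
    and Dp: "darboux_transform A fp \<eta>p gp \<theta>p \<mu>" and Dm: "darboux_transform A fm \<eta>m gm \<theta>m \<mu>"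
    using L unfolding lie_darboux_transform_def by simp_all
  obtain \<tau>' where \<tau>': "isotropic_gauge A fp \<eta>p fm \<eta>m \<tau>'" "\<And>x. gm x = op_exp (\<lambda>z. \<mu> *\<^sub>R \<tau>' x z) ` gp x"
    using L unfolding lie_darboux_transform_def by (elim conjE exE) simp
  have \<mu>: "\<mu> \<noteq> 0" and nop: "\<not> orthogonal_lines (fp x) (gp x)" and nom: "\<not> orthogonal_lines (fm x) (gm x)" for x
    using Dp Dm unfolding darboux_transform_def by simp_all
  have "\<tau> = \<tau>'" by (rule isotropic_gauge_unique[OF A \<Omega>i \<tau> isotropic_gauge_except[OF A \<tau>'(1)] \<mu>])
  then have gm: "gm x = op_exp (\<lambda>z. \<mu> *\<^sub>R \<tau> x z) ` gp x" for x by (simp only: \<tau>'(2))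
  note pi = omega_surface_planes[OF \<Omega>i] and pj = omega_surface_planes[OF \<Omega>]
  have \<tau>w: "\<tau> x \<in> wedge_sub (fp x) (fm x)" for x using \<tau> unfolding isotropic_gauge_def by simp
  have nz: "\<tau> x \<noteq> (\<lambda>_. 0)" for x
  proof
    assume "\<tau> x = (\<lambda>_. 0)"
    then have "gm x = gp x"
      unfolding gm wedge_sub_null_plane(2)[OF pi(1-3) \<tau>w] by simp
    moreover obtain w where w: "gp x = span {w}" using pj(2)[of x] unfolding null_line_def by blast
    ultimately have "gp x \<oplus>\<^sub>s gm x = span {w}" by (simp add: plus_sub_lines)
    then have "dim (gp x \<oplus>\<^sub>s gm x) = dim {w}" by simp
    also have "\<dots> \<le> 1" using dim_le_card'[of "{w}"] by simp
    finally show False using pj(1)[of x] unfolding null_plane_def by simp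
  qed
  have i: "spans_null_plane (fp x) (fm x) (\<tau> x)" for x
    by (rule spans_null_planeI[OF pi(1-3) \<tau>w nz])
  then show "spans_null_plane (fp x) (fm x) (\<tau> x)" .
  have "\<exists>\<rho>. spans_null_plane (gp x) (gm x) \<rho> \<and> isotropic_edge (fp x) (fm x) (\<tau> x) (gp x) (gm x) \<rho> \<mu>" for x
    by (rule isotropic_edge_exists[OF i pj(2) gm nop nom \<mu>]) (rule exI, rule conjI)
  then obtain \<rho> where \<rho>: "\<And>x. spans_null_plane (gp x) (gm x) (\<rho> x)"
      "\<And>x. isotropic_edge (fp x) (fm x) (\<tau> x) (gp x) (gm x) (\<rho> x) \<mu>"
    by metis
  have "gauge_except A gp \<theta>p gm \<theta>m \<mu> \<rho>"
    by (rule darboux_transform_gauge[OF A pi(4,5) Dp Dm \<tau> i \<rho>])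
  then have "\<sigma> = \<rho>" by (rule isotropic_gauge_unique[OF A \<Omega> \<sigma> _ \<mu>])
  then show "isotropic_edge (fp x) (fm x) (\<tau> x) (gp x) (gm x) (\<sigma> x) \<mu>" using \<rho>(2) by simp
qed

section \<open>Conserved quantities\<close>

text \<open>A conserved quantity is killed by \<open>\<eta> = \<sigma> \<and> \<xi>\<close>. If \<open>(\<sigma>, c) \<noteq> 0\<close>, then \<open>\<xi>\<close> would be a multiple of \<open>\<sigma>\<close> and
  \<open>\<eta>\<close> would vanish.\<close>

lemma conserved_quantity_perp:
  assumes A: "smooth_surface A" and f: "isothermic A f \<eta>" and c: "conserved_quantity A \<eta> c"
  shows "c \<in> perp (f x)"
proof -
  have "x \<in> (\<Union>(W, p)\<in>A. p ` W)" using A unfolding smooth_surface_def by simp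
  then obtain W p u where u: "(W, p) \<in> A" "u \<in> W" and x: "x = p u" by auto
  have \<eta>: "\<forall>\<kappa>\<in>A. \<forall>u\<in>fst \<kappa>. \<forall>v. \<eta> \<kappa> u v \<in> wedge_sub (f (snd \<kappa> u)) (perp (f (snd \<kappa> u)))"
    and nz: "\<forall>\<kappa>\<in>A. \<forall>u\<in>fst \<kappa>. \<exists>v z. \<eta> \<kappa> u v z \<noteq> 0"
    and line: "null_line (f x)"
    using f unfolding isothermic_def nowhere_zero_form_def smooth_line_map_def by simp_all
  obtain v z where v: "\<eta> (W, p) u v z \<noteq> 0"
    using nz[rule_format, OF u(1), of u] u(2) by auto
  have "\<eta> (W, p) u v \<in> wedge_sub (f x) (perp (f x))"
    using \<eta>[rule_format, OF u(1), of u v] u(2) x by simp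
  then obtain \<sigma> \<xi> where \<sigma>: "\<sigma> \<in> f x" and \<xi>: "\<xi> \<in> perp (f x)" and \<eta>': "\<eta> (W, p) u v = wedge \<sigma> \<xi>"
    unfolding wedge_sub_def by blast
  have "conn \<eta> 1 (\<lambda>_. c) (W, p) u v = 0"
    using c[unfolded conserved_quantity_def, THEN conjunct2, THEN spec, rule_format, OF u(1)] u(2) by simp
  then have "wedge \<sigma> \<xi> c = 0"
    unfolding conn_def section_deriv_def \<eta>'[symmetric] by (simp add: o_def frechet_derivative_const)
  then have dep: "ip \<sigma> c *\<^sub>R \<xi> = ip \<xi> c *\<^sub>R \<sigma>" by (simp add: wedge_def)
  have nz': "wedge \<sigma> \<xi> \<noteq> (\<lambda>_. 0)" using v unfolding \<eta>' by auto
  have \<sigma>c: "ip \<sigma> c = 0"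
  proof (rule ccontr)
    assume n: "ip \<sigma> c \<noteq> 0"
    then have "\<xi> = (ip \<xi> c / ip \<sigma> c) *\<^sub>R \<sigma>"
      using arg_cong[OF dep, of "\<lambda>y. (1 / ip \<sigma> c) *\<^sub>R y"] by simp
    then have "wedge \<sigma> \<xi> = wedge \<sigma> ((ip \<xi> c / ip \<sigma> c) *\<^sub>R \<sigma>)" by simp
    also have "\<dots> = (\<lambda>_. 0)" unfolding wedge_scale_right by (simp add: wedge_def)
    finally show False using nz' by contradiction
  qed
  obtain w where w: "f x = span {w}" using line unfolding null_line_def by blast
  obtain r where r: "\<sigma> = r *\<^sub>R w" using \<sigma> unfolding w mem_line by (elim exE)
  have "r \<noteq> 0" using wedge_dependent(3)[OF nz'] r by auto
  with \<sigma>c have "ip c w = 0" unfolding r by (simp add: ip_bilinear ip_commute)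
  show ?thesis
    unfolding perp_def w mem_Collect_eq
  proof (intro ballI)
    fix y assume "y \<in> span {w}"
    then obtain r where "y = r *\<^sub>R w" unfolding mem_line by (elim exE)
    with \<open>ip c w = 0\<close> show "ip c y = 0" by (simp add: ip_bilinear)
  qed
qed

lemma Gam_fixes_perp:
  assumes "null_line f" "null_line g" "\<not> orthogonal_lines f g" "s \<noteq> 0" "c \<in> perp f" "c \<in> perp g"
  shows "Gam f g s c = c"
proof -
  obtain u where u: "ip u u = 0" "f = span {u}" using assms(1) unfolding null_line_def by blast
  obtain w where w: "g = span {w}" "ip w w = 0" "ip u w = 1"
    using null_line_normalized[OF assms(2)] assms(3) u(2) by metis
  have "ip c u = 0" "ip c w = 0" using assms(5,6) unfolding perp_def u w by (simp_all add: span_base)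
  then have "ip u c = 0" "ip w c = 0" by (simp_all add: ip_commute)
  then show ?thesis using u w assms(4) by (simp add: Gam_span boost_def)
qed

section \<open>Discrete surfaces from Bianchi-Darboux transforms\<close>

theorem corollary3p5:
  fixes A :: "'a::{t2_space,second_countable_topology} param set"
    and fp fm :: "nat \<Rightarrow> nat \<Rightarrow> 'a \<Rightarrow> r42 set"
    and \<eta>p \<eta>m :: "nat \<Rightarrow> nat \<Rightarrow> 'a one_form"
    and \<alpha> \<beta> :: "nat \<Rightarrow> real" and c :: r42
  assumes surface: "smooth_surface A" "simply_connected (UNIV :: 'a set)"
    and initial: "L_isothermic A (fp 0 0) (\<eta>p 0 0) (fm 0 0) (\<eta>m 0 0) c"
    and horizontal: "\<And>m. bianchi_darboux_transform A c
          (fp m 0) (\<eta>p m 0) (fm m 0) (\<eta>m m 0)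
          (fp (Suc m) 0) (\<eta>p (Suc m) 0) (fm (Suc m) 0) (\<eta>m (Suc m) 0) (\<alpha> m)"
    and vertical: "\<And>n. bianchi_darboux_transform A c
          (fp 0 n) (\<eta>p 0 n) (fm 0 n) (\<eta>m 0 n)
          (fp 0 (Suc n)) (\<eta>p 0 (Suc n)) (fm 0 (Suc n)) (\<eta>m 0 (Suc n)) (\<beta> n)"
    and distinct_params: "\<And>m n. \<alpha> m \<noteq> \<beta> n"
    and permutability:
      "\<And>m n. bianchi_permuted (fp m n) (fp (Suc m) n) (fp (Suc m) (Suc n)) (fp m (Suc n)) (\<alpha> m) (\<beta> n)"
      "\<And>m n. bianchi_permuted (fm m n) (fm (Suc m) n) (fm (Suc m) (Suc n)) (fm m (Suc n)) (\<alpha> m) (\<beta> n)"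
    and nondegenerate:
      "\<And>m n x. \<not> orthogonal_lines (fp m n x) (fp (Suc m) n x)"
      "\<And>m n x. \<not> orthogonal_lines (fp m n x) (fp m (Suc n) x)"
      "\<And>m n x. \<not> orthogonal_lines (fm m n x) (fm (Suc m) n x)"
      "\<And>m n x. \<not> orthogonal_lines (fm m n x) (fm m (Suc n) x)"
  shows "\<forall>x. discrete_L_isothermic (\<lambda>m n. fp m n x \<oplus>\<^sub>s fm m n x)"
proof
  fix x
  have Lh: "lie_darboux_transform A (fp m 0) (\<eta>p m 0) (fm m 0) (\<eta>m m 0)
      (fp (Suc m) 0) (\<eta>p (Suc m) 0) (fm (Suc m) 0) (\<eta>m (Suc m) 0) (\<alpha> m)"
    and ch: "c \<in> perp (fp (Suc m) 0 x)" for m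
    using horizontal[of m] unfolding bianchi_darboux_transform_def by simp_all
  have Lv: "lie_darboux_transform A (fp 0 n) (\<eta>p 0 n) (fm 0 n) (\<eta>m 0 n)
      (fp 0 (Suc n)) (\<eta>p 0 (Suc n)) (fm 0 (Suc n)) (\<eta>m 0 (Suc n)) (\<beta> n)"
    and cv: "c \<in> perp (fp 0 (Suc n) x)" for n
    using vertical[of n] unfolding bianchi_darboux_transform_def by simp_all
  have \<Omega>h: "omega_surface A (fp m 0) (\<eta>p m 0) (fm m 0) (\<eta>m m 0)"
    and \<Omega>v: "omega_surface A (fp 0 m) (\<eta>p 0 m) (fm 0 m) (\<eta>m 0 m)"
    and params: "\<alpha> m \<noteq> 0" "\<beta> m \<noteq> 0" for m
    using Lh[of m] Lv[of m] unfolding lie_darboux_transform_def darboux_transform_def by simp_all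
  have "\<exists>\<tau>. isotropic_gauge A (fp m 0) (\<eta>p m 0) (fm m 0) (\<eta>m m 0) \<tau>" for m
    using \<Omega>h[of m] unfolding omega_surface_def isotropic_darboux_pair_def by simp
  then obtain \<tau>h where \<tau>h: "\<And>m. isotropic_gauge A (fp m 0) (\<eta>p m 0) (fm m 0) (\<eta>m m 0) (\<tau>h m)" by metis
  have "\<exists>\<tau>. isotropic_gauge A (fp 0 n) (\<eta>p 0 n) (fm 0 n) (\<eta>m 0 n) \<tau>" for n
    using \<Omega>v[of n] unfolding omega_surface_def isotropic_darboux_pair_def by simp
  then obtain \<tau>v where \<tau>v: "\<And>n. isotropic_gauge A (fp 0 n) (\<eta>p 0 n) (fm 0 n) (\<eta>m 0 n) (\<tau>v n)" by metis
  have corner: "\<tau>v 0 = \<tau>h 0"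
    by (rule isotropic_gauge_unique[OF surface(1) \<Omega>h \<tau>v isotropic_gauge_except[OF surface(1) \<tau>h] zero_neq_one[symmetric]])
  have permuted: "fp (Suc m) (Suc n) x = Gam (fp m n x) (fp (Suc m) n x) (1 - \<beta> n / \<alpha> m) ` fp m (Suc n) x"
    "fm (Suc m) (Suc n) x = Gam (fm m n x) (fm (Suc m) n x) (1 - \<beta> n / \<alpha> m) ` fm m (Suc n) x" for m n
    using permutability[of m n] unfolding bianchi_permuted_def by simp_all
  obtain \<tau> where V: "\<And>m n. spans_null_plane (fp m n x) (fm m n x) (\<tau> m n)"
    and H: "\<And>m n. isotropic_edge (fp m n x) (fm m n x) (\<tau> m n) (fp (Suc m) n x) (fm (Suc m) n x) (\<tau> (Suc m) n) (\<alpha> m)"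
    and W: "\<And>m n. isotropic_edge (fp m n x) (fm m n x) (\<tau> m n) (fp m (Suc n) x) (fm m (Suc n) x) (\<tau> m (Suc n)) (\<beta> n)"
    by (rule isotropic_lattice[of "\<lambda>m n. fp m n x" "\<lambda>m n. fm m n x" "\<lambda>m. \<tau>h m x" \<alpha> "\<lambda>n. \<tau>v n x" \<beta>,
        OF lie_darboux_edge[OF surface(1) Lh \<Omega>h \<tau>h \<tau>h] lie_darboux_edge[OF surface(1) Lv \<Omega>v \<tau>v \<tau>v]
          fun_cong[OF corner] permuted params distinct_params nondegenerate])
      (rule that; assumption)
  note lines = spans_null_planeD(1,2)[OF V]
  note sqp = bianchi_square[OF lines(1) lines(1) lines(1) permuted(1) params distinct_params nondegenerate(1,2,2)]
  note sqm = bianchi_square[OF lines(2) lines(2) lines(2) permuted(2) params distinct_params nondegenerate(3,4,4)]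
  let ?a = "\<lambda>m n::nat. \<alpha> m" and ?b = "\<lambda>m::nat. \<beta>"
  have labels: "edge_labeling ?a ?b" unfolding edge_labeling_def using params by simp
  have iso: "discrete_isothermic (\<lambda>m n. fp m n x) ?a ?b" "discrete_isothermic (\<lambda>m n. fm m n x) ?a ?b"
    unfolding discrete_isothermic_def dconn_def
    by (intro conjI allI impI labels lines nondegenerate sqp(3) sqm(3); assumption)+
  have "discrete_isotropic_darboux_pair (\<lambda>m n. fp m n x) (\<lambda>m n. fm m n x) ?a ?b"
    unfolding discrete_isotropic_darboux_pair_def dconn_def
    by (intro conjI iso exI[of _ \<tau>] allI impI spans_null_planeD(4)[OF V]
        H[unfolded isotropic_edge_def, THEN conjunct2, rule_format]
        W[unfolded isotropic_edge_def, THEN conjunct2, rule_format])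
  then have \<Omega>: "discrete_omega_spanned (\<lambda>m n. fp m n x \<oplus>\<^sub>s fm m n x) (\<lambda>m n. fp m n x) (\<lambda>m n. fm m n x) ?a ?b"
    unfolding discrete_omega_spanned_def using spans_null_planeD(3)[OF V] by simp
  have cq: "conserved_quantity A (\<eta>p 0 0) c" and cc: "ip c c = 0"
    using initial unfolding L_isothermic_def by simp_all
  have c_nz: "c \<noteq> 0" using cq unfolding conserved_quantity_def by (rule conjunct1)
  have c_corner: "c \<in> perp (fp 0 0 x)"
    by (rule conserved_quantity_perp[OF surface(1) omega_surface_planes(8)[OF \<Omega>h] cq])
  have c: "c \<in> perp (fp m n x)" for m n
  proof (induction n arbitrary: m)
    case 0
    show ?case using c_corner ch by (cases m) simp_all
  next
    case (Suc n)
    note row = Suc.IH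
    show ?case
    proof (induction m)
      case 0
      show ?case by (rule cv)
    next
      case (Suc m)
      show ?case by (rule sqp(4)[OF row row Suc.IH])
    qed
  qed
  have "discrete_conserved_quantity (\<lambda>m n. fp m n x) ?a ?b c"
    unfolding discrete_conserved_quantity_def dconn_def
    by (intro conjI allI impI c_nz Gam_fixes_perp lines nondegenerate c; use params in simp)
  with \<Omega> cc show "discrete_L_isothermic (\<lambda>m n. fp m n x \<oplus>\<^sub>s fm m n x)"
    unfolding discrete_L_isothermic_def by blast
qed

end
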